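(* Let $p$ be a prime with $p \equiv 1 \pmod 4$, let $q = p^{p-1}$, and let $E/\mathbb{F}_p$ be the elliptic curve $y^2 = x^3 + x$. Then the following three conditions are equivalent: (1) $p$ is $1$-exceptional for $m = 4$; (2) $E_{p-1} \equiv 0 \pmod{p^2}$; (3) $\#E(\mathbb{F}_q) \equiv 0 \pmod{p^2}$. Here $\{E_n\}$ are the Euler numbers, given by \[ \frac{2}{e^x + e^{-x}} = \sum_{n=0}^{\infty} E_n \frac{x^n}{n!}. \]
   Context: For a prime $p$ and a positive integer $m$ with $p \equiv 1 \pmod m$, the prime $p$ is called $1$-exceptional for $m$ if \[ \prod_{\substack{1 \le a \le (p^2-1)/m \\ \gcd(a,p)=1}} a^{p-1} \equiv 1 \pmod{p^2}. \] *)

theory Defs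
  imports
    "HOL-Number_Theory.Number_Theory"
    "HOL-Computational_Algebra.Formal_Power_Series"
    "HOL-Algebra.Ring"
begin

definition one_exceptional :: "nat \<Rightarrow> nat \<Rightarrow> bool" where
  "one_exceptional p m \<longleftrightarrow>
     prime p \<and> m > 0 \<and> [p = 1] (mod m) \<and>
     [(\<Prod>a \<in> {a. 1 \<le> a \<and> a \<le> (p\<^sup>2 - 1) div m \<and> coprime a p}. a ^ (p - 1)) = 1] (mod p\<^sup>2)"

definition euler_egf :: "rat fps" where
  "euler_egf = 2 / (fps_exp 1 + fps_exp (- 1))"

text \<open>
  The Euler numbers are integers, and divisibility statements about them are meant in the
  integers; lemma \<open>of_int_euler_number\<close> below shows that the description is well-defined.
\<close>
definition euler_number :: "nat \<Rightarrow> int" where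
  "euler_number n = (THE k. of_int k = fact n * fps_nth euler_egf n)"

lemma euler_egf_mult: "euler_egf * (fps_exp 1 + fps_exp (- 1)) = 2"
proof -
  have "fps_nth (fps_exp 1 + fps_exp (- 1) :: rat fps) 0 \<noteq> 0"
    by simp
  then have "(fps_exp 1 + fps_exp (- 1) :: rat fps) dvd 2"
    using fps_is_unit_iff unit_imp_dvd by blast
  then show ?thesis
    unfolding euler_egf_def by (rule dvd_div_mult_self)
qed

lemma euler_egf_recurrence:
  "fact n * fps_nth euler_egf n =
     (if n = 0 then 1 else 0)
     - (\<Sum>i<n. if even (n - i) then of_nat (n choose i) * (fact i * fps_nth euler_egf i) else 0)"
proof -
  let ?t = "\<lambda>i. if even (n - i) then of_nat (n choose i) * (fact i * fps_nth euler_egf i) else 0"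
  have "(if n = 0 then 2 else 0) = fact n * fps_nth (euler_egf * (fps_exp 1 + fps_exp (- 1))) n"
    by (simp add: euler_egf_mult fps_numeral_nth)
  also have "\<dots> = fact n * (\<Sum>i\<le>n. fps_nth euler_egf i * ((1 + (- 1) ^ (n - i)) / fact (n - i)))"
    by (simp add: fps_mult_nth add_divide_distrib atLeast0AtMost)
  also have "\<dots> = (\<Sum>i\<le>n. 2 * ?t i)"
    unfolding sum_distrib_left
    by (intro sum.cong) (auto simp: binomial_fact)
  also have "\<dots> = 2 * (fact n * fps_nth euler_egf n + sum ?t {..<n})"
    by (simp add: lessThan_Suc_atMost [symmetric] sum_distrib_left)
  finally show ?thesis
    by (auto split: if_splits)
qed

lemma euler_egf_Ints: "fact n * fps_nth euler_egf n \<in> \<int>"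
proof (induction n rule: less_induct)
  case (less n)
  then show ?case
    by (subst euler_egf_recurrence) (intro Ints_diff Ints_sum, auto intro!: Ints_mult)
qed

lemma of_int_euler_number: "of_int (euler_number n) = fact n * fps_nth euler_egf n"
proof -
  obtain k where "of_int k = fact n * fps_nth euler_egf n"
    using euler_egf_Ints by (metis Ints_cases)
  then show ?thesis
    unfolding euler_number_def by (metis (mono_tags, lifting) of_int_eq_iff the_equality)
qed

datatype 'a curve_point = Infinity | Affine 'a 'a

text \<open>
  The points over the field \<open>F\<close> of the projective curve with affine equation
  \<open>y\<^sup>2 = x\<^sup>3 + a x + b\<close>; it meets the line at infinity in exactly one point.
\<close>
definition weierstrass_points ::
    "('a, 'r) ring_scheme \<Rightarrow> 'a \<Rightarrow> 'a \<Rightarrow> 'a curve_point set" where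
  "weierstrass_points F a b =
     insert Infinity
       {Affine x y | x y. x \<in> carrier F \<and> y \<in> carrier F \<and>
          y [^]\<^bsub>F\<^esub> (2::nat) = x [^]\<^bsub>F\<^esub> (3::nat) \<oplus>\<^bsub>F\<^esub> a \<otimes>\<^bsub>F\<^esub> x \<oplus>\<^bsub>F\<^esub> b}"

end

theory Submission
  imports
    Defs
    "HOL-Computational_Algebra.Polynomial"
    "HOL-Algebra.Multiplicative_Group"
begin

text \<open>
  Write \<open>p = 4 k + 1\<close> and \<open>m = (p\<^sup>2 - 1) / 4 = p k + k\<close>, and let \<open>G\<close> be the product of the
  integers in \<open>{1..m}\<close> that are prime to \<open>p\<close>, a Gauss factorial. Put \<open>x = G ^ (p - 1)\<close>, so that
  \<open>x \<equiv> 1\<close> modulo \<open>p\<close>. Each of the three conditions says that \<open>x \<equiv> 1\<close> modulo \<open>p\<^sup>2\<close>: the first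
  one by definition, the second one because \<open>E\<^bsub>p-1\<^esub> \<equiv> 4 (x - 1)\<close>, and the third one because the
  number of points is congruent to \<open>2 (x - 1)\<close>, both modulo \<open>p\<^sup>2\<close>.

  The Euler number (\<open>euler_number_cong_gauss_fact\<close>). For odd \<open>N\<close> the generating function gives
  \<open>E\<^bsub>n\<^esub>\<close> modulo \<open>N\<close> as the alternating sum of the \<open>n\<close>-th powers of the first \<open>N\<close> odd numbers. For
  \<open>N = p\<^sup>2 = 4 m + 1\<close> and even \<open>n\<close>, centring this sum at its middle term expresses \<open>E\<^bsub>n\<^esub>\<close> by the
  sums of \<open>i ^ n\<close> over \<open>i \<le> m\<close> and over \<open>i \<le> 2 m\<close>. For \<open>n = p - 1\<close> a power of an \<open>i\<close> prime to
  \<open>p\<close> is \<open>1\<close> modulo \<open>p\<close>, so that modulo \<open>p\<^sup>2\<close> such sums are products in disguise; the one over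
  \<open>i \<le> 2 m\<close> is a Wilson-type product over half of the units modulo \<open>p\<^sup>2\<close> and contributes nothing.

  The number of points (\<open>card_points_cong_gauss_fact\<close>). Let \<open>g\<close> generate the multiplicative group
  of the field and let \<open>f\<close> be a monic integer lift of its minimal polynomial over the prime field.
  The ring \<open>\<int>[X] / (p\<^sup>2, f)\<close> has the given field as its residue field, contains \<open>\<int> / p\<^sup>2\<close>, and the
  \<open>p\<close>-th power of a lift depends only on the element that is lifted. Hence the quadratic character
  of \<open>u\<^sup>3 + u\<close> is the power with exponent \<open>p (q - 1) / 2\<close> of any lift of \<open>u\<^sup>3 + u\<close>. With
  Teichmueller lifts of \<open>u\<close>, that is with \<open>(q - 1)\<close>-st roots of unity, expanding and summing over
  \<open>u\<close> leaves the binomial coefficients whose exponent of \<open>u\<close> is divisible by \<open>q - 1\<close>. So the number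
  of points is \<open>1 - S\<close> modulo \<open>p\<^sup>2\<close>, where \<open>S\<close> is the sum of the binomial coefficients
  \<open>(2 p K) choose (l K)\<close> over the odd \<open>l < 2 p\<close>, and \<open>K = (q - 1) / 4\<close>.

  The binomial sum (\<open>sum_choose_odd_quarters_cong\<close>). All digits of \<open>K\<close> in base \<open>p\<close> are equal to
  \<open>k\<close>. Put \<open>\<Delta> = H\<^bsub>2k\<^esub> - H\<^bsub>k\<^esub>\<close>, a difference of harmonic numbers. The term \<open>l = p\<close> is congruent to
  \<open>(2 K) choose K\<close>; splitting off the multiples of \<open>p\<close> in the factorials, digit by digit, turns it
  into a power of \<open>G\<close> times \<open>1 + p \<Delta> / 2\<close>. If \<open>l \<equiv> 3\<close> modulo \<open>4\<close>, at least two carries occur and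
  the term vanishes. If \<open>l \<equiv> 1\<close> modulo \<open>4\<close> and \<open>l \<noteq> p\<close>, exactly one carry occurs, and Lucas'
  theorem gives the term modulo \<open>p\<^sup>2\<close>; by the exact identity \<open>alternating_choose_harmonic\<close> these terms
  add up to \<open>- p \<Delta> / 2\<close>. The two contributions of \<open>\<Delta>\<close> cancel, and \<open>S \<equiv> 3 - 2 x\<close>.
\<close>

section \<open>Euler numbers modulo odd integers\<close>

text \<open>
  The sum telescopes, because multiplying \<open>exp ((2 j + 1) x)\<close> by \<open>exp x + exp (- x)\<close> gives
  \<open>exp ((2 j + 2) x) + exp (2 j x)\<close>.
\<close>

lemma alternating_exp_sum:
  "(\<Sum>j<N. (-1) ^ j * fps_exp (of_nat (2 * j + 1))) * (fps_exp 1 + fps_exp (- 1)) =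
     (1 - (-1) ^ N * fps_exp (of_nat (2 * N)) :: rat fps)"
proof (induction N)
  case (Suc N)
  have e: "fps_exp (of_nat (2 * N + 1)) * fps_exp 1 = (fps_exp (of_nat (2 * Suc N)) :: rat fps)"
    "fps_exp (of_nat (2 * N + 1)) * fps_exp (-1) = (fps_exp (of_nat (2 * N)) :: rat fps)"
    by (simp_all flip: fps_exp_add_mult add: algebra_simps)
  have "(\<Sum>j<Suc N. (-1) ^ j * fps_exp (of_nat (2 * j + 1))) * (fps_exp 1 + fps_exp (- 1)) =
     (1 - (-1) ^ N * fps_exp (of_nat (2 * N)) :: rat fps) +
     (-1) ^ N * (fps_exp (of_nat (2 * N + 1)) * fps_exp 1 + fps_exp (of_nat (2 * N + 1)) * fps_exp (-1))"
    by (simp only: Suc.IH [symmetric] sum.lessThan_Suc) (simp only: distrib_right distrib_left mult.assoc add_ac)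
  also have "\<dots> = 1 - (-1) ^ Suc N * fps_exp (of_nat (2 * Suc N))"
    unfolding e by (simp add: algebra_simps)
  finally show ?case .
qed (simp add: algebra_simps)

lemma fps_nth_minus_one_power_mult:
  "fps_nth ((-1) ^ j * f :: rat fps) n = (-1) ^ j * fps_nth f n"
  by (induction j) auto

text \<open>
  Multiplying \<open>alternating_exp_sum\<close> by the generating function of the Euler numbers cancels the
  factor \<open>exp x + exp (- x)\<close>; the identity compares the coefficients of \<open>x ^ n / n!\<close> that remain.
\<close>

lemma euler_number_alternating_sum:
  assumes "odd N"
  shows "(\<Sum>i\<le>n. int (n choose i) * euler_number i * (2 * int N) ^ (n - i)) + euler_number n =
           2 * (\<Sum>j<N. (-1) ^ j * (2 * int j + 1) ^ n)"
proof -
  let ?S = "\<Sum>j<N. (-1) ^ j * fps_exp (of_nat (2 * j + 1)) :: rat fps"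
  have "euler_egf * (?S * (fps_exp 1 + fps_exp (- 1))) = 2 * ?S"
    by (subst mult.left_commute) (simp only: euler_egf_mult mult.commute)
  also have "?S * (fps_exp 1 + fps_exp (- 1)) = 1 + fps_exp (of_nat (2 * N))"
    unfolding alternating_exp_sum using assms by simp
  finally have "fact n * fps_nth (euler_egf * fps_exp (of_nat (2 * N)) + euler_egf) n
      = fact n * fps_nth (2 * ?S) n"
    by (simp only: distrib_left mult_1_right add.commute)
  moreover have "fact n * fps_nth (2 * ?S) n = of_int (2 * (\<Sum>j<N. (-1) ^ j * (2 * int j + 1) ^ n))"
  proof -
    have "fps_nth ?S n = (\<Sum>j<N. (-1) ^ j * of_nat (2 * j + 1) ^ n / fact n)"
      by (simp add: fps_sum_nth fps_nth_minus_one_power_mult)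
    also have "\<dots> = of_int (\<Sum>j<N. (-1) ^ j * (2 * int j + 1) ^ n) / fact n"
      by (simp add: sum_divide_distrib add.commute)
    finally show ?thesis
      by (simp only: mult_2 fps_add_nth) (simp add: distrib_left)
  qed
  moreover have "fact n * fps_nth (euler_egf * fps_exp (of_nat (2 * N))) n =
     of_int (\<Sum>i\<le>n. int (n choose i) * euler_number i * (2 * int N) ^ (n - i))"
  proof -
    have "fact n * (fps_nth euler_egf i * (of_nat (2 * N) ^ (n - i) / fact (n - i))) =
        of_int (int (n choose i) * euler_number i * (2 * int N) ^ (n - i))" if "i \<le> n" for i
      using that by (simp add: of_int_euler_number binomial_fact)
    then show ?thesis
      by (simp add: fps_mult_nth atLeast0AtMost sum_distrib_left)
  qed
  ultimately have "(of_int ((\<Sum>i\<le>n. int (n choose i) * euler_number i * (2 * int N) ^ (n - i)) + euler_number n) :: rat) =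
           of_int (2 * (\<Sum>j<N. (-1) ^ j * (2 * int j + 1) ^ n))"
    by (simp only: fps_add_nth distrib_left of_int_add of_int_euler_number)
  then show ?thesis
    by (simp only: of_int_eq_iff)
qed

text \<open>
  Modulo \<open>N\<close> only the term \<open>i = n\<close> of the previous identity survives, and \<open>2\<close> can be cancelled.
\<close>

lemma euler_number_cong_alternating_sum:
  assumes "odd N"
  shows "[euler_number n = (\<Sum>j<N. (-1) ^ j * (2 * int j + 1) ^ n)] (mod int N)"
proof -
  have "[(\<Sum>i\<le>n. int (n choose i) * euler_number i * (2 * int N) ^ (n - i)) =
      (\<Sum>i\<le>n. if i = n then euler_number n else 0)] (mod int N)"
    by (intro cong_sum) (auto simp: cong_0_iff)
  then have "[(\<Sum>i\<le>n. int (n choose i) * euler_number i * (2 * int N) ^ (n - i)) + euler_number n =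
      2 * euler_number n] (mod int N)"
    unfolding mult_2 [of "euler_number n"] by (intro cong_add) auto
  then have "[2 * euler_number n = 2 * (\<Sum>j<N. (-1) ^ j * (2 * int j + 1) ^ n)] (mod int N)"
    unfolding euler_number_alternating_sum [OF assms] by (rule cong_sym)
  moreover have "coprime 2 (int N)"
    using assms by simp
  ultimately show ?thesis
    using cong_mult_lcancel by blast
qed

lemma alternating_sum_even_split:
  "(\<Sum>i=1..2*m. (-1) ^ i * f i) = 2 * (\<Sum>c=1..m. f (2 * c)) - (\<Sum>i=1..2*m. f i :: int)"
  by (induction m) (auto simp: algebra_simps)

text \<open>
  The alternating sum of the previous congruence for \<open>N = 4 m + 1\<close> has its middle term at \<open>j = 2 m\<close>,
  where \<open>2 j + 1 = N\<close>. The terms at distance \<open>i\<close> from it are \<open>\<plusminus> 2 i\<close> modulo \<open>N\<close>, and they agree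
  because \<open>n\<close> is even. So the sum is twice the alternating sum of the \<open>(2 i) ^ n\<close> for \<open>i \<le> 2 m\<close>,
  whose even terms are once more multiples of \<open>n\<close>-th powers.
\<close>

lemma euler_number_cong_power_sums:
  assumes "even n" "n > 0"
  shows "[euler_number n = 2 * 2 ^ n * (2 * 2 ^ n * (\<Sum>i=1..m. int i ^ n) - (\<Sum>i=1..2*m. int i ^ n))]
    (mod int (4 * m + 1))"
proof -
  let ?M = "int (4 * m + 1)" and ?f = "\<lambda>j::nat. (-1) ^ j * (2 * int j + 1) ^ n"
  have f: "[?f (2 * m + i) = 2 ^ n * ((-1) ^ i * int i ^ n)] (mod ?M)" for i
  proof -
    have "[2 * int (2 * m + i) + 1 = 2 * int i] (mod ?M)"
      by (simp add: cong_iff_dvd_diff add.commute)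
    then have "[(2 * int (2 * m + i) + 1) ^ n = (2 * int i) ^ n] (mod ?M)"
      by (rule cong_pow)
    then have "[(-1) ^ i * (2 * int (2 * m + i) + 1) ^ n = (-1) ^ i * (2 * int i) ^ n] (mod ?M)"
      by (rule cong_scalar_left)
    then show ?thesis
      by (simp add: power_add power_mult_distrib mult_ac)
  qed
  have f': "[?f (2 * m - i) = 2 ^ n * ((-1) ^ i * int i ^ n)] (mod ?M)" if "i \<le> 2 * m" for i
  proof -
    have "[2 * int (2 * m - i) + 1 = - (2 * int i)] (mod ?M)"
      using that by (simp add: cong_iff_dvd_diff of_nat_diff algebra_simps)
    then have "[(2 * int (2 * m - i) + 1) ^ n = (2 * int i) ^ n] (mod ?M)"
      using assms(1) by (metis cong_pow power_minus_even)
    moreover have "(-1) ^ (2 * m - i) = ((-1) ^ i :: int)"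
      using that by (simp add: minus_one_power_iff)
    ultimately have "[(-1) ^ (2 * m - i) * (2 * int (2 * m - i) + 1) ^ n = (-1) ^ i * (2 * int i) ^ n] (mod ?M)"
      by (simp add: cong_scalar_left)
    then show ?thesis
      by (simp add: power_mult_distrib mult_ac)
  qed
  let ?g = "\<lambda>i::nat. 2 ^ n * ((-1) ^ i * int i ^ n)"
  have *: "{..<4*m+1} = {..<2*m} \<union> ({2*m} \<union> {2*m+1..4*m})"
    by auto
  have "(\<Sum>j<4*m+1. ?f j) = (\<Sum>j<2*m. ?f j) + (\<Sum>j\<in>{2*m} \<union> {2*m+1..4*m}. ?f j)"
    unfolding * by (rule sum.union_disjoint) auto
  also have "(\<Sum>j\<in>{2*m} \<union> {2*m+1..4*m}. ?f j) = ?f (2*m) + (\<Sum>j=2*m+1..4*m. ?f j)"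
    by (subst sum.union_disjoint) auto
  also have "(\<Sum>j<2*m. ?f j) = (\<Sum>i=1..2*m. ?f (2*m-i))"
    by (rule sum.reindex_bij_witness [of _ "\<lambda>i. 2*m-i" "\<lambda>i. 2*m-i"]) auto
  also have "(\<Sum>j=2*m+1..4*m. ?f j) = (\<Sum>i=1..2*m. ?f (2*m+i))"
    by (rule sum.reindex_bij_witness [of _ "\<lambda>i. 2*m+i" "\<lambda>i. i-2*m"]) auto
  finally have split: "(\<Sum>j<4*m+1. ?f j) =
      (\<Sum>i=1..2*m. ?f (2*m-i)) + (?f (2*m) + (\<Sum>i=1..2*m. ?f (2*m+i)))" .
  have "[?f (2*m) = 0] (mod ?M)"
    using f [of 0] assms(2) by (simp only: add_0_right of_nat_0 zero_power mult_zero_right)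
  then have *: "[(\<Sum>j<4*m+1. ?f j) = (\<Sum>i=1..2*m. ?g i) + (0 + (\<Sum>i=1..2*m. ?g i))] (mod ?M)"
    unfolding split by (intro cong_add cong_sum f f') simp_all
  have "[euler_number n = (\<Sum>j<4*m+1. ?f j)] (mod ?M)"
    by (rule euler_number_cong_alternating_sum) simp
  note cong_trans [OF this *]
  moreover have "(\<Sum>i=1..2*m. ?g i) + (0 + (\<Sum>i=1..2*m. ?g i)) = 2 * 2 ^ n * (\<Sum>i=1..2*m. (-1) ^ i * int i ^ n)"
    by (simp flip: sum_distrib_left)
  moreover have "(\<Sum>c=1..m. int (2 * c) ^ n) = 2 ^ n * (\<Sum>c=1..m. int c ^ n)"
    by (simp add: power_mult_distrib sum_distrib_left)
  ultimately show ?thesis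
    unfolding alternating_sum_even_split by (simp only: mult.assoc)
qed

section \<open>Gauss factorials modulo the square of a prime\<close>

text \<open>
  The Gauss factorial for a prime \<open>p\<close>: the part of \<open>n!\<close> that comes from the factors prime to \<open>p\<close>.
\<close>

definition gauss_fact :: "nat \<Rightarrow> nat \<Rightarrow> nat" where
  "gauss_fact p n = (\<Prod>a=1..n. if p dvd a then 1 else a)"

lemma gauss_fact_0 [simp]: "gauss_fact p 0 = 1"
  by (simp add: gauss_fact_def)

lemma gauss_fact_Suc: "gauss_fact p (Suc n) = gauss_fact p n * (if p dvd Suc n then 1 else Suc n)"
  by (simp add: gauss_fact_def)

lemma fact_eq_gauss_fact:
  assumes "p > 0"
  shows "fact n = p ^ (n div p) * fact (n div p) * gauss_fact p n"
proof (induction n)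
  case (Suc n)
  show ?case
  proof (cases "p dvd Suc n")
    case True
    then have eq1: "Suc n div p = Suc (n div p)"
      by (simp add: div_Suc dvd_eq_mod_eq_0)
    then have eq2: "p * Suc (n div p) = Suc n"
      using True dvd_mult_div_cancel [of p "Suc n"] by (simp only:)
    have "fact (Suc n) = (p * Suc (n div p)) * (p ^ (n div p) * fact (n div p) * gauss_fact p n)"
      unfolding Suc.IH [symmetric] eq2 by simp
    also have "\<dots> = p ^ Suc (n div p) * fact (Suc (n div p)) * gauss_fact p n"
      by (simp add: algebra_simps)
    finally show ?thesis
      using True by (simp add: gauss_fact_Suc eq1)
  next
    case False
    then have "Suc n div p = n div p"
      by (simp add: div_Suc dvd_eq_mod_eq_0)
    then show ?thesis
      using False Suc by (simp add: gauss_fact_Suc mult_ac del: mult_Suc mult_Suc_right)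
  qed
qed simp

text \<open>
  The shape \<open>p a + r\<close> separates the complete blocks between multiples of \<open>p\<close>, whose products
  are all congruent modulo \<open>p\<^sup>2\<close>, from the incomplete last one.
\<close>

lemma gauss_fact_block:
  assumes "r < p"
  shows "gauss_fact p (p * a + r) = gauss_fact p (p * a) * (\<Prod>u=1..r. p * a + u)"
  using assms
proof (induction r)
  case (Suc r)
  have "\<not> p dvd p * a + Suc r"
    using Suc.prems by (metis dvd_add_right_iff dvd_triv_left nat_dvd_not_less zero_less_Suc)
  then show ?case
    using Suc by (simp add: gauss_fact_Suc mult_ac)
qed simp

lemma gauss_fact_mult_Suc:
  assumes "p > 0"
  shows "gauss_fact p (p * Suc a) = gauss_fact p (p * a) * (\<Prod>u=1..p-1. p * a + u)"
proof -
  have eq: "p * Suc a = Suc (p * a + (p - 1))"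
    using assms by simp
  have "p dvd Suc (p * a + (p - 1))"
    unfolding eq [symmetric] by simp
  then show ?thesis
    using gauss_fact_block [of "p - 1" p a] assms unfolding eq gauss_fact_Suc by simp
qed

lemma coprime_gauss_fact: "prime p \<Longrightarrow> coprime (gauss_fact p n) p"
  unfolding gauss_fact_def
  by (intro prod_coprime_left) (auto simp: prime_imp_coprime coprime_commute [of _ p])

text \<open>
  Of the two factors of \<open>x\<^sup>2 - y\<^sup>2\<close> only \<open>x - y\<close> can absorb \<open>p\<close>, since \<open>x + y \<equiv> 2 y\<close> is a unit.
\<close>

lemma cong_square_root:
  fixes x y :: int
  assumes "[x\<^sup>2 = y\<^sup>2] (mod (int p)\<^sup>2)" "[x = y] (mod int p)" "prime p" "odd p" "\<not> int p dvd y"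
  shows "[x = y] (mod (int p)\<^sup>2)"
proof -
  have "\<not> int p dvd x + y"
  proof
    assume "int p dvd x + y"
    moreover have "int p dvd x - y"
      using assms(2) by (simp add: cong_iff_dvd_diff)
    ultimately have "int p dvd (x + y) - (x - y)"
      by (rule dvd_diff)
    then have "int p dvd 2 * y"
      by simp
    moreover have "coprime (int p) 2"
      using assms(4) by (simp add: coprime_commute)
    ultimately show False
      using assms(5) by (simp add: coprime_dvd_mult_right_iff)
  qed
  then have "coprime ((int p)\<^sup>2) (x + y)"
    using assms(3) by (simp add: prime_imp_coprime)
  moreover have "(int p)\<^sup>2 dvd (x - y) * (x + y)"
    using assms(1) by (simp add: cong_iff_dvd_diff power2_eq_square algebra_simps)
  ultimately show ?thesis
    by (simp add: cong_iff_dvd_diff coprime_dvd_mult_left_iff)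
qed

text \<open>
  Pairing \<open>u\<close> with \<open>p - u\<close> shows that the square of the product does not depend on \<open>a\<close> modulo
  \<open>p\<^sup>2\<close>, because \<open>(p a + u) (p a + p - u) = p\<^sup>2 (a\<^sup>2 + a) + u (p - u)\<close>; the product itself does not
  depend on \<open>a\<close> modulo \<open>p\<close>, which fixes the square root.
\<close>

lemma prod_block_cong:
  assumes "prime p" "odd p"
  shows "[(\<Prod>u=1..p-1. p * a + u) = fact (p - 1)] (mod p\<^sup>2)"
proof -
  let ?Q = "\<Prod>u=1..p-1. p * a + u" 
  have fact_sq: "(fact (p - 1))\<^sup>2 = (\<Prod>u=1..p-1. u * (p - u))"
  proof -
    have "fact (p - 1) = (\<Prod>u=1..p-1. p - u)"
      unfolding fact_prod of_nat_id
      by (rule prod.reindex_bij_witness [of _ "\<lambda>i. p-i" "\<lambda>i. p-i"]) auto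
    then show ?thesis
      by (simp add: power2_eq_square prod.distrib fact_prod)
  qed
  have "?Q = (\<Prod>u=1..p-1. p * a + (p - u))"
    by (rule prod.reindex_bij_witness [of _ "\<lambda>i. p-i" "\<lambda>i. p-i"]) auto
  then have "?Q\<^sup>2 = (\<Prod>u=1..p-1. (p * a + u) * (p * a + (p - u)))"
    by (simp add: power2_eq_square prod.distrib)
  also have "[\<dots> = (\<Prod>u=1..p-1. u * (p - u))] (mod p\<^sup>2)"
  proof (intro cong_prod)
    fix u assume "u \<in> {1..p-1}"
    then obtain v where v: "p = u + v"
      by (metis atLeastAtMost_iff diff_le_self le_add_diff_inverse order_trans)
    have "(p * a + u) * (p * a + v) = p\<^sup>2 * (a\<^sup>2 + a) + u * v"
      by (simp add: v power2_eq_square algebra_simps)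
    then show "[(p * a + u) * (p * a + (p - u)) = u * (p - u)] (mod p\<^sup>2)"
      unfolding v by (simp add: cong_def)
  qed
  finally have sq: "[?Q\<^sup>2 = (fact (p - 1))\<^sup>2] (mod p\<^sup>2)"
    unfolding fact_sq .
  have "[?Q = (\<Prod>u=1..p-1. u)] (mod p)"
    by (intro cong_prod) (auto simp: cong_def)
  then have "[?Q = fact (p - 1)] (mod p)"
    by (simp add: fact_prod)
  moreover have "\<not> p dvd fact (p - 1)"
    using assms(1) prime_dvd_fact_iff [of p "p - 1"] prime_gt_0_nat [of p] by auto
  ultimately show ?thesis
    using cong_square_root [of "int ?Q" "int (fact (p - 1))" p] sq assms
    by (metis cong_int_iff int_dvd_int_iff of_nat_power)
qed

lemma gauss_fact_mult_cong:
  assumes "prime p" "odd p"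
  shows "[gauss_fact p (p * a) = fact (p - 1) ^ a] (mod p\<^sup>2)"
proof (induction a)
  case (Suc a)
  then show ?case
    unfolding gauss_fact_mult_Suc [OF prime_gt_0_nat [OF assms(1)]] power_Suc2
    by (intro cong_mult prod_block_cong assms)
qed simp

text \<open>
  All factorials in the binomial coefficient are replaced by Gauss factorials. As there is no carry
  (\<open>s \<le> r\<close>), the powers of \<open>p\<close> cancel, and the factorials of the quotients by \<open>p\<close> form the
  binomial coefficient of the leading digits.
\<close>

lemma choose_gauss_fact:
  assumes "prime p" "s \<le> r" "r < p" "b \<le> a"
  shows "((p * a + r) choose (p * b + s)) * (gauss_fact p (p * b + s) * gauss_fact p (p * (a - b) + (r - s))) =
    (a choose b) * gauss_fact p (p * a + r)"
proof -
  have p: "p > 0"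
    using assms(1) prime_gt_0_nat by blast
  have le: "p * b + s \<le> p * a + r"
    using assms by (simp add: add_mono)
  have eq: "p * a + r - (p * b + s) = p * (a - b) + (r - s)"
  proof -
    obtain c d where "a = b + c" "r = s + d"
      using assms by (metis le_add_diff_inverse)
    then show ?thesis
      by (simp add: algebra_simps)
  qed
  have f: "fact (p * c + u) = p ^ c * fact c * gauss_fact p (p * c + u)" if "u < p" for c u
    using fact_eq_gauss_fact [OF p, of "p * c + u"] that by simp
  let ?c = "(p * a + r) choose (p * b + s)"
  have fac: "fact (p * b + s) * fact (p * (a - b) + (r - s)) * ?c = fact (p * a + r)"
    using binomial_fact_lemma [OF le] by (simp only: eq)
  have pow: "p ^ b * p ^ (a - b) = p ^ a"
    using assms by (simp flip: power_add)
  have ch: "fact b * fact (a - b) * (a choose b) = (fact a :: nat)"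
    using assms by (simp add: binomial_fact_lemma)
  have "(p ^ a * (fact b * fact (a - b))) *
      (?c * (gauss_fact p (p * b + s) * gauss_fact p (p * (a - b) + (r - s)))) =
      (p ^ b * fact b * gauss_fact p (p * b + s)) *
      (p ^ (a - b) * fact (a - b) * gauss_fact p (p * (a - b) + (r - s))) * ?c"
    unfolding pow [symmetric] by (simp only: mult_ac)
  also have "\<dots> = fact (p * b + s) * fact (p * (a - b) + (r - s)) * ?c"
    using assms f [of s b] f [of "r - s" "a - b"] by simp
  also have "\<dots> = p ^ a * (fact b * fact (a - b) * (a choose b)) * gauss_fact p (p * a + r)"
    unfolding fac ch using assms f [of r a] by simp
  finally have "(p ^ a * (fact b * fact (a - b))) *
      (?c * (gauss_fact p (p * b + s) * gauss_fact p (p * (a - b) + (r - s)))) =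
      (p ^ a * (fact b * fact (a - b))) * ((a choose b) * gauss_fact p (p * a + r))"
    by (simp only: mult.assoc)
  then show ?thesis
    using p by simp
qed

lemma fermat_power:
  assumes "prime p" "\<not> p dvd a"
  shows "[int a ^ (p - 1) = 1] (mod int p)"
  using cong_int_iff [THEN iffD2, OF fermat_theorem [OF assms]] by simp

text \<open>
  The linear term of the expansion of a product of numbers \<open>1 + (f a - 1)\<close>. It translates between
  the multiplicative condition for exceptional primes and power sums.
\<close>

lemma prod_one_plus_cong:
  fixes f :: "'a \<Rightarrow> int"
  assumes "finite S" "\<And>a. a \<in> S \<Longrightarrow> [f a = 1] (mod d)"
  shows "[prod f S = 1 + (\<Sum>a\<in>S. f a - 1)] (mod d\<^sup>2)" "[prod f S = 1] (mod d)"
proof -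
  have "[prod f S = 1 + (\<Sum>a\<in>S. f a - 1)] (mod d\<^sup>2) \<and> [prod f S = 1] (mod d)"
    using assms
  proof (induction S rule: finite_induct)
    case (insert x S)
    have IH: "[prod f S = 1 + (\<Sum>a\<in>S. f a - 1)] (mod d\<^sup>2)" "[prod f S = 1] (mod d)"
      using insert by auto
    have x: "[f x = 1] (mod d)"
      using insert by auto
    have "[f x * prod f S = 1 * 1] (mod d)"
      by (intro cong_mult IH x)
    moreover have "[f x * prod f S = 1 + ((f x - 1) + (\<Sum>a\<in>S. f a - 1))] (mod d\<^sup>2)"
    proof -
      have "d * d dvd (f x - 1) * (prod f S - 1)"
        using IH(2) x by (intro mult_dvd_mono) (auto simp: cong_iff_dvd_diff)
      then have "[(f x - 1) * (prod f S - 1) = 0] (mod d\<^sup>2)"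
        by (simp add: cong_0_iff power2_eq_square)
      then have "[(f x - 1) * (prod f S - 1) + (f x - 1 + prod f S) =
          0 + (f x - 1 + (1 + (\<Sum>a\<in>S. f a - 1)))] (mod d\<^sup>2)"
        by (intro cong_add IH) auto
      then show ?thesis
        by (simp add: algebra_simps)
    qed
    ultimately show ?case
      using insert.hyps by simp
  qed auto
  then show "[prod f S = 1 + (\<Sum>a\<in>S. f a - 1)] (mod d\<^sup>2)" "[prod f S = 1] (mod d)"
    by auto
qed

lemma int_gauss_fact_power:
  "int (gauss_fact p n) ^ e = (\<Prod>a=1..n. if p dvd a then 1 else int a ^ e)"
  unfolding gauss_fact_def prod_power_distrib of_nat_prod
  by (intro prod.cong) auto

lemma sum_not_dvd:
  assumes "p > 0"
  shows "(\<Sum>a=1..n. if p dvd a then 0 else 1) = int (n - n div p)"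
proof (induction n)
  case (Suc n)
  have "n div p \<le> n" by simp
  with Suc assms show ?case
    by (auto simp: div_Suc dvd_eq_mod_eq_0 of_nat_diff Suc_diff_le)
qed simp

text \<open>
  By Fermat's theorem the powers \<open>a ^ (p - 1)\<close> with \<open>a\<close> prime to \<open>p\<close> are \<open>1\<close> modulo \<open>p\<close>, so that
  their product is governed by their sum; multiples of \<open>p\<close> contribute \<open>0\<close> to the sum modulo \<open>p\<^sup>2\<close>.
\<close>

lemma power_sum_cong_gauss_fact:
  assumes "prime p" "p > 2"
  shows "[(\<Sum>a=1..n. int a ^ (p - 1)) = int (gauss_fact p n) ^ (p - 1) - 1 + int (n - n div p)] (mod (int p)\<^sup>2)"
proof -
  let ?f = "\<lambda>a. if p dvd a then 1 else int a ^ (p - 1)"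
  have "[?f a = 1] (mod int p)" for a
    using fermat_power [OF assms(1), of a] by auto
  then have 1: "[int (gauss_fact p n) ^ (p - 1) = 1 + (\<Sum>a=1..n. ?f a - 1)] (mod (int p)\<^sup>2)"
    unfolding int_gauss_fact_power by (intro prod_one_plus_cong) auto
  have "[(\<Sum>a=1..n. int a ^ (p - 1)) = (\<Sum>a=1..n. (?f a - 1) + (if p dvd a then 0 else 1))] (mod (int p)\<^sup>2)"
  proof (intro cong_sum)
    fix a
    have "(int p)\<^sup>2 dvd int a ^ (p - 1)" if "p dvd a"
    proof -
      have "int p ^ (p - 1) dvd int a ^ (p - 1)"
        using that by (intro dvd_power_same) simp
      moreover have "(int p)\<^sup>2 dvd int p ^ (p - 1)"
        using assms by (intro le_imp_power_dvd) auto
      ultimately show ?thesis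
        using dvd_trans by blast
    qed
    then show "[int a ^ (p - 1) = (?f a - 1) + (if p dvd a then 0 else 1)] (mod (int p)\<^sup>2)"
      by (auto simp: cong_0_iff)
  qed
  also have "(\<Sum>a=1..n. (?f a - 1) + (if p dvd a then 0 else 1)) = (\<Sum>a=1..n. ?f a - 1) + int (n - n div p)"
    using sum_not_dvd [of p n] prime_gt_0_nat [OF assms(1)] by (simp add: sum.distrib)
  also have "[\<dots> = int (gauss_fact p n) ^ (p - 1) - 1 + int (n - n div p)] (mod (int p)\<^sup>2)"
    using cong_diff [OF 1 cong_refl [of 1], THEN cong_sym] by (intro cong_add) auto
  finally show ?thesis .
qed

text \<open>
  The product of all units modulo \<open>p\<^sup>2\<close> is \<open>(p - 1)! ^ p\<close>, whose power with exponent \<open>p - 1\<close> is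
  trivial by Euler's theorem. Since \<open>a\<close> and \<open>p\<^sup>2 - a\<close> have the same even powers, that power is also
  the square of the contribution of the first half, which is then determined by being \<open>1\<close> modulo
  \<open>p\<close>.
\<close>

lemma gauss_fact_half_power_cong:
  assumes "prime p" "odd p" "p\<^sup>2 = 2 * h + 1"
  shows "[int (gauss_fact p h) ^ (p - 1) = 1] (mod (int p)\<^sup>2)"
proof -
  let ?f = "\<lambda>a. if p dvd a then 1 else int a ^ (p - 1)" and ?M = "(int p)\<^sup>2"
  have ev: "even (p - 1)"
    using assms(2) by simp
  have "gauss_fact p (p * p) = gauss_fact p (2 * h)"
    using assms(3) gauss_fact_Suc [of p "2 * h"] by (simp add: power2_eq_square) (metis dvd_triv_left)
  then have "[gauss_fact p (2 * h) = fact (p - 1) ^ p] (mod p\<^sup>2)"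
    using gauss_fact_mult_cong [OF assms(1,2), of p] by simp
  then have "[gauss_fact p (2 * h) ^ (p - 1) = (fact (p - 1) ^ p) ^ (p - 1)] (mod p\<^sup>2)"
    by (rule cong_pow)
  also have "(fact (p - 1) ^ p) ^ (p - 1) = (fact (p - 1) ^ totient (p\<^sup>2) :: nat)"
    using assms(1) totient_prime_power [of p 2] by (simp add: power_mult [symmetric])
  also have "[\<dots> = 1] (mod p\<^sup>2)"
    using assms(1) prime_dvd_fact_iff [of p "p - 1"] prime_gt_0_nat [of p]
    by (intro euler_theorem) (auto simp: coprime_commute prime_imp_coprime)
  finally have 1: "[int (gauss_fact p (2 * h)) ^ (p - 1) = 1] (mod ?M)"
    by (metis cong_int_iff of_nat_1 of_nat_power)
  have "{1..2*h} = {1..h} \<union> {h+1..2*h}"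
    by auto
  then have "int (gauss_fact p (2 * h)) ^ (p - 1) = (\<Prod>a=1..h. ?f a) * (\<Prod>a=h+1..2*h. ?f a)"
    unfolding int_gauss_fact_power by (simp only:) (rule prod.union_disjoint; auto)
  also have "(\<Prod>a=h+1..2*h. ?f a) = (\<Prod>a=1..h. ?f (p\<^sup>2 - a))"
    using assms(3) by (intro prod.reindex_bij_witness [of _ "\<lambda>i. p\<^sup>2-i" "\<lambda>i. p\<^sup>2-i"]) auto
  finally have split: "int (gauss_fact p (2 * h)) ^ (p - 1) = (\<Prod>a=1..h. ?f a) * (\<Prod>a=1..h. ?f (p\<^sup>2 - a))" .
  have "[(\<Prod>a=1..h. ?f a) * (\<Prod>a=1..h. ?f (p\<^sup>2 - a)) = (\<Prod>a=1..h. ?f a) * (\<Prod>a=1..h. ?f a)] (mod ?M)"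
  proof (intro cong_mult cong_prod cong_refl)
    fix a assume "a \<in> {1..h}"
    then have a: "a \<le> p\<^sup>2"
      using assms(3) by auto
    have d: "p dvd p\<^sup>2 - a \<longleftrightarrow> p dvd a"
      using a by (meson dvd_diffD1 dvd_diff_nat dvd_power pos2)
    have "[int (p\<^sup>2 - a) = - int a] (mod ?M)"
      using a by (simp add: cong_iff_dvd_diff of_nat_diff)
    then have "[int (p\<^sup>2 - a) ^ (p - 1) = int a ^ (p - 1)] (mod ?M)"
      using ev by (metis cong_pow power_minus_even)
    then show "[?f (p\<^sup>2 - a) = ?f a] (mod ?M)"
      unfolding d by simp
  qed
  then have "[int (gauss_fact p (2 * h)) ^ (p - 1) = (int (gauss_fact p h) ^ (p - 1))\<^sup>2] (mod ?M)"
    by (simp only: split int_gauss_fact_power [of p h] power2_eq_square)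
  then have "[(int (gauss_fact p h) ^ (p - 1))\<^sup>2 = 1\<^sup>2] (mod ?M)"
    unfolding one_power2 using 1 cong_sym cong_trans by blast
  moreover have "[int (gauss_fact p h) ^ (p - 1) = 1] (mod int p)"
  proof (rule fermat_power [OF assms(1)])
    show "\<not> p dvd gauss_fact p h"
      using coprime_gauss_fact [OF assms(1), of h] assms(1) coprime_absorb_right not_prime_unit by blast
  qed
  moreover have "\<not> int p dvd 1"
    using assms(1) prime_gt_1_nat by fastforce
  ultimately show ?thesis
    by (rule cong_square_root [OF _ _ assms(1,2)])
qed

section \<open>Congruences between rational numbers integral at a prime\<close>

text \<open>
  Membership in the localisation of \<open>\<int>\<close> at \<open>p\<close>, as a subring of \<open>\<rat>\<close>. Working in \<open>\<rat>\<close> makes exact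
  identities between harmonic sums and quotients of binomial coefficients available modulo powers
  of \<open>p\<close>.
\<close>

definition p_integral :: "nat \<Rightarrow> rat \<Rightarrow> bool" where
  "p_integral p x \<longleftrightarrow> (\<exists>a b. \<not> int p dvd b \<and> x * of_int b = of_int a)"

definition pcong :: "nat \<Rightarrow> nat \<Rightarrow> rat \<Rightarrow> rat \<Rightarrow> bool" where
  "pcong p n x y \<longleftrightarrow> (\<exists>z. p_integral p z \<and> x - y = of_nat (p ^ n) * z)"

context
  fixes p :: nat
  assumes p: "prime p"
begin

lemma not_dvd_1: "\<not> int p dvd 1"
  using p prime_gt_1_nat by fastforce

lemma p_integral_of_int [simp]: "p_integral p (of_int a)"
  unfolding p_integral_def using not_dvd_1 by (intro exI [of _ a] exI [of _ 1]) simp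

lemma p_integral_of_nat [simp]: "p_integral p (of_nat a)"
  using p_integral_of_int [of "int a"] by simp

lemma p_integral_numeral [simp]: "p_integral p (numeral a)" "p_integral p 0" "p_integral p 1"
  using p_integral_of_int [of "numeral a"] p_integral_of_int [of 0] p_integral_of_int [of 1] by simp_all

lemma p_integral_add: assumes "p_integral p x" "p_integral p y" shows "p_integral p (x + y)"
proof -
  obtain a b c d where *: "\<not> int p dvd b" "x * of_int b = of_int a" "\<not> int p dvd d" "y * of_int d = of_int c"
    using assms unfolding p_integral_def by blast
  have "(x + y) * of_int (b * d) = (x * of_int b) * of_int d + (y * of_int d) * of_int b"
    by (simp add: algebra_simps)
  also have "\<dots> = of_int (a * d + c * b)"
    by (simp add: *)
  finally show ?thesis
    using * p unfolding p_integral_def by (intro exI [of _ "a * d + c * b"] exI [of _ "b * d"]) (auto simp: prime_dvd_mult_iff)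
qed

lemma p_integral_mult: assumes "p_integral p x" "p_integral p y" shows "p_integral p (x * y)"
proof -
  obtain a b c d where *: "\<not> int p dvd b" "x * of_int b = of_int a" "\<not> int p dvd d" "y * of_int d = of_int c"
    using assms unfolding p_integral_def by blast
  have "(x * y) * of_int (b * d) = (x * of_int b) * (y * of_int d)"
    by (simp add: algebra_simps)
  also have "\<dots> = of_int (a * c)"
    by (simp add: *)
  finally show ?thesis
    using * p unfolding p_integral_def by (intro exI [of _ "a * c"] exI [of _ "b * d"]) (auto simp: prime_dvd_mult_iff)
qed

lemma p_integral_uminus: "p_integral p x \<Longrightarrow> p_integral p (- x)"
  using p_integral_mult [of "of_int (-1)" x] by (simp del: of_int_minus add: p_integral_of_int) simp

lemma p_integral_diff: "p_integral p x \<Longrightarrow> p_integral p y \<Longrightarrow> p_integral p (x - y)"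
  using p_integral_add [of x "- y"] p_integral_uminus [of y] by simp

lemma p_integral_sum: "(\<And>i. i \<in> S \<Longrightarrow> p_integral p (f i)) \<Longrightarrow> p_integral p (sum f S)"
  by (induction S rule: infinite_finite_induct) (auto intro: p_integral_add)

lemma p_integral_power: "p_integral p x \<Longrightarrow> p_integral p (x ^ n)"
  by (induction n) (auto intro: p_integral_mult)

lemma p_integral_divide: assumes "p_integral p x" "\<not> p dvd d" shows "p_integral p (x / of_nat d)"
proof -
  have "p_integral p (1 / of_nat d)"
    unfolding p_integral_def using assms(2) by (intro exI [of _ 1] exI [of _ "int d"]) (cases "d = 0"; simp)
  then show ?thesis
    using p_integral_mult [OF assms(1)] by fastforce
qed

lemma pcong_refl [simp, intro]: "pcong p n x x"
  unfolding pcong_def by (intro exI [of _ 0]) simp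

lemma pcong_sym: assumes "pcong p n x y" shows "pcong p n y x"
proof -
  obtain z where z: "p_integral p z" "x - y = of_nat (p ^ n) * z"
    using assms unfolding pcong_def by blast
  then have "y - x = of_nat (p ^ n) * (- z)"
    by (simp add: algebra_simps)
  with z show ?thesis
    unfolding pcong_def using p_integral_uminus by blast
qed

lemma pcong_add: assumes "pcong p n x y" "pcong p n x' y'" shows "pcong p n (x + x') (y + y')"
proof -
  obtain z z' where z: "p_integral p z" "x - y = of_nat (p ^ n) * z" "p_integral p z'" "x' - y' = of_nat (p ^ n) * z'"
    using assms unfolding pcong_def by blast
  then have "x + x' - (y + y') = of_nat (p ^ n) * (z + z')"
    by (simp add: algebra_simps)
  with z show ?thesis
    unfolding pcong_def using p_integral_add by blast
qed

lemma pcong_trans [trans]: assumes "pcong p n x y" "pcong p n y z" shows "pcong p n x z"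
proof -
  have "pcong p n (x + y) (y + z)"
    using assms by (rule pcong_add)
  then show ?thesis
    unfolding pcong_def by (simp add: algebra_simps)
qed

lemma pcong_mult_left: assumes "p_integral p c" "pcong p n x y" shows "pcong p n (c * x) (c * y)"
proof -
  obtain z where z: "p_integral p z" "x - y = of_nat (p ^ n) * z"
    using assms unfolding pcong_def by blast
  then have "c * x - c * y = of_nat (p ^ n) * (c * z)"
    by (metis mult.left_commute right_diff_distrib)
  with z assms(1) show ?thesis
    unfolding pcong_def using p_integral_mult by blast
qed

lemma pcong_mult:
  assumes "pcong p n x y" "pcong p n x' y'" "p_integral p x" "p_integral p y'"
  shows "pcong p n (x * x') (y * y')"
proof -
  have "pcong p n (x * x') (x * y')" "pcong p n (y' * x) (y' * y)"
    using assms by (simp_all add: pcong_mult_left)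
  then show ?thesis
    by (metis mult.commute pcong_trans)
qed

lemma pcong_sum: "(\<And>i. i \<in> S \<Longrightarrow> pcong p n (f i) (g i)) \<Longrightarrow> pcong p n (sum f S) (sum g S)"
  by (induction S rule: infinite_finite_induct) (auto intro: pcong_add)

lemma pcong_p_mult: assumes "pcong p n x y" shows "pcong p (Suc n) (of_nat p * x) (of_nat p * y)"
proof -
  obtain z where z: "p_integral p z" "x - y = of_nat (p ^ n) * z"
    using assms unfolding pcong_def by blast
  then have "of_nat p * x - of_nat p * y = of_nat (p ^ Suc n) * z"
    by (metis (no_types) mult.assoc of_nat_mult power_Suc right_diff_distrib)
  with z show ?thesis
    unfolding pcong_def by blast
qed

lemma pcong_cancel:
  assumes "\<not> p dvd c" "pcong p n (of_nat c * x) (of_nat c * y)"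
  shows "pcong p n x y"
proof -
  obtain z where z: "p_integral p z" "of_nat c * x - of_nat c * y = of_nat (p ^ n) * z"
    using assms(2) unfolding pcong_def by blast
  have "of_nat c \<noteq> (0 :: rat)"
    using assms(1) by (intro notI) simp
  then have "x - y = of_nat (p ^ n) * (z / of_nat c)"
    using z(2) by (simp add: field_simps)
  then show ?thesis
    unfolding pcong_def using p_integral_divide [OF z(1) assms(1)] by blast
qed

lemma pcong_of_int_iff: "pcong p n (of_int a) (of_int b) \<longleftrightarrow> [a = b] (mod int p ^ n)"
proof
  assume "pcong p n (of_int a) (of_int b)"
  then obtain z c d where z: "(of_int a - of_int b :: rat) = of_nat (p ^ n) * z" "\<not> int p dvd d" "z * of_int d = of_int c"
    unfolding pcong_def p_integral_def by blast
  then have "of_int ((a - b) * d) = (of_int (int p ^ n * c) :: rat)"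
    by simp
  then have "(a - b) * d = int p ^ n * c"
    by (simp only: of_int_eq_iff)
  then have "int p ^ n dvd (a - b) * d"
    by simp
  moreover have "coprime (int p ^ n) d"
    using z(2) p by (simp add: prime_imp_coprime)
  ultimately show "[a = b] (mod int p ^ n)"
    by (simp add: cong_iff_dvd_diff coprime_dvd_mult_left_iff)
next
  assume "[a = b] (mod int p ^ n)"
  then obtain c where "a - b = int p ^ n * c"
    by (auto simp: cong_iff_dvd_diff)
  then have "(of_int a - of_int b :: rat) = (of_nat (p ^ n) * of_int c :: rat)"
    by (metis of_int_diff of_int_mult of_int_of_nat_eq of_nat_power)
  then show "pcong p n (of_int a) (of_int b)"
    unfolding pcong_def using p_integral_of_int by blast
qed

lemma pcong_of_nat_iff: "pcong p n (of_nat a) (of_nat b) \<longleftrightarrow> [a = b] (mod p ^ n)"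
  using pcong_of_int_iff [of n "int a" "int b"] by (simp flip: cong_int_iff)

lemma pcong_prod_one_plus:
  assumes "finite S" "\<And>i. i \<in> S \<Longrightarrow> p_integral p (z i)"
  shows "pcong p 2 (\<Prod>i\<in>S. 1 + of_nat p * z i) (1 + of_nat p * (\<Sum>i\<in>S. z i))"
  using assms
proof (induction S rule: finite_induct)
  case (insert x S)
  let ?s = "\<Sum>i\<in>S. z i"
  have int: "p_integral p (z x)" "p_integral p ?s"
    using insert.prems by (auto intro: p_integral_sum)
  have "pcong p 2 ((1 + of_nat p * z x) * (\<Prod>i\<in>S. 1 + of_nat p * z i)) ((1 + of_nat p * z x) * (1 + of_nat p * ?s))"
    using insert int by (intro pcong_mult_left p_integral_add p_integral_mult) auto
  also have "pcong p 2 \<dots> (1 + of_nat p * (z x + ?s))"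
    unfolding pcong_def
    by (rule exI [of _ "z x * ?s"]) (simp add: int p_integral_mult algebra_simps power2_eq_square)
  finally show ?case
    using insert.hyps by simp
qed simp

end


section \<open>An alternating binomial sum with harmonic value\<close>

text \<open>
  The factor \<open>of_nat M - 1\<close> clears the denominator of the closed form, which makes the induction on
  \<open>J\<close> a polynomial identity.
\<close>

lemma alternating_weighted_choose_sum:
  "(of_nat M - 1) * (\<Sum>j\<le>J. (-1) ^ j * (of_nat M - 2 * of_nat j) * of_nat (M choose j)) =
     (-1) ^ J * of_nat (J + 1) * (of_nat M - 1 - 2 * of_nat J) * (of_nat (M choose Suc J) :: rat)"
proof (induction J)
  case (Suc J)
  have *: "of_nat (J + 2) * of_nat (M choose (J + 2)) = (of_nat M - of_nat J - 1) * (of_nat (M choose (J + 1)) :: rat)"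
    using gbinomial_mult_1 [of "of_nat M :: rat" "J + 1"] by (simp add: binomial_gbinomial algebra_simps)
  have "(of_nat M - 1) * (\<Sum>j\<le>Suc J. (-1) ^ j * (of_nat M - 2 * of_nat j) * of_nat (M choose j)) =
      (-1) ^ J * of_nat (J + 1) * (of_nat M - 1 - 2 * of_nat J) * of_nat (M choose Suc J) +
      (of_nat M - 1) * ((-1) ^ Suc J * (of_nat M - 2 * of_nat (Suc J)) * (of_nat (M choose Suc J) :: rat))"
    by (simp only: sum.atMost_Suc distrib_left Suc.IH)
  also have "\<dots> = (-1) ^ Suc J * (of_nat M - 1 - 2 * of_nat (Suc J)) * ((of_nat M - of_nat J - 1) * of_nat (M choose (J + 1)))"
    by (simp add: algebra_simps)
  also have "\<dots> = (-1) ^ Suc J * of_nat (Suc J + 1) * (of_nat M - 1 - 2 * of_nat (Suc J)) * of_nat (M choose Suc (Suc J))"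
    unfolding * [symmetric] by (simp add: mult_ac)
  finally show ?case .
qed simp

text \<open>
  The case \<open>M = 2 m\<close>, \<open>J = m - 1\<close> of the previous sum, after the substitution \<open>j = m - d\<close>.
\<close>

lemma alternating_central_choose_sum:
  assumes "m > 0"
  shows "(\<Sum>d=1..m. (-1) ^ d * of_nat d * (of_nat ((2 * m) choose (m - d)) / of_nat ((2 * m) choose m))) =
    - (of_nat m / (2 * (2 * of_nat m - 1)) :: rat)"
proof -
  have pos: "of_nat ((2 * m) choose m) \<noteq> (0 :: rat)" "2 * of_nat m - 1 \<noteq> (0 :: rat)"
    using assms by (auto simp: algebra_simps)
  have "(\<Sum>d=1..m. (-1) ^ d * of_nat d * of_nat ((2 * m) choose (m - d))) =
      (\<Sum>j\<le>m-1. (-1) ^ m * ((-1) ^ j * of_nat (m - j) * (of_nat ((2 * m) choose j) :: rat)))"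
  proof -
    have "(\<Sum>d=1..m. (-1) ^ d * of_nat d * of_nat ((2 * m) choose (m - d))) =
        (\<Sum>j\<le>m-1. (-1) ^ (m - j) * of_nat (m - j) * (of_nat ((2 * m) choose (m - (m - j))) :: rat))"
      by (rule sum.reindex_bij_witness [of _ "\<lambda>j. m - j" "\<lambda>d. m - d"]) (use assms in auto)
    also have "\<dots> = (\<Sum>j\<le>m-1. (-1) ^ m * ((-1) ^ j * of_nat (m - j) * (of_nat ((2 * m) choose j) :: rat)))"
    proof (intro sum.cong refl)
      fix j assume "j \<in> {..m-1}"
      then have "m - (m - j) = j" "(-1) ^ (m - j) = ((-1) ^ m * (-1) ^ j :: rat)"
        using assms by (auto simp: minus_one_power_iff)
      then show "(-1) ^ (m - j) * of_nat (m - j) * (of_nat ((2 * m) choose (m - (m - j))) :: rat) =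
          (-1) ^ m * ((-1) ^ j * of_nat (m - j) * of_nat ((2 * m) choose j))"
        by simp
    qed
    finally show ?thesis .
  qed
  also have "2 * \<dots> = (-1) ^ m * (\<Sum>j\<le>m-1. (-1) ^ j * (of_nat (2 * m) - 2 * of_nat j) * (of_nat ((2 * m) choose j) :: rat))"
    unfolding sum_distrib_left using assms by (intro sum.cong refl) (auto simp: of_nat_diff)
  finally have "(2 * of_nat m - 1) * (2 * (\<Sum>d=1..m. (-1) ^ d * of_nat d * of_nat ((2 * m) choose (m - d)))) =
      (-1) ^ m * ((of_nat (2 * m) - 1) * (\<Sum>j\<le>m-1. (-1) ^ j * (of_nat (2 * m) - 2 * of_nat j) * (of_nat ((2 * m) choose j) :: rat)))"
    by simp
  also have "\<dots> = - (of_nat m * of_nat ((2 * m) choose m))"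
    unfolding alternating_weighted_choose_sum using assms
    by (cases m) (auto simp: algebra_simps simp flip: power_add mult_2)
  finally have "(\<Sum>d=1..m. (-1) ^ d * of_nat d * of_nat ((2 * m) choose (m - d))) =
      - (of_nat m / (2 * (2 * of_nat m - 1))) * (of_nat ((2 * m) choose m) :: rat)"
    using pos(2) by (simp add: field_simps)
  then show ?thesis
    using pos(1) by (simp add: sum_divide_distrib [symmetric])
qed

lemma central_choose_ratio_Suc:
  assumes "d \<le> k"
  shows "of_nat ((2 * k) choose (k - d)) / of_nat ((2 * k) choose k) =
    of_nat ((2 * Suc k) choose (Suc k - d)) / of_nat ((2 * Suc k) choose Suc k) *
      (1 - (of_nat d / of_nat (Suc k)) ^ 2 :: rat)"
proof -
  obtain e where k: "k = d + e"
    using assms le_iff_add by auto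
  have A: "of_nat ((2 * n) choose (n - d)) / of_nat ((2 * n) choose n) = (fact n)\<^sup>2 / (fact (n - d) * fact (n + d) :: rat)"
    if "d \<le> n" for n
  proof -
    have "2 * n - (n - d) = n + d" "2 * n - n = n"
      using that by auto
    then show ?thesis
      using that by (simp add: binomial_fact power2_eq_square)
  qed
  have f: "fact (Suc k - d) = of_nat (Suc e) * (fact (k - d) :: rat)"
    "fact (Suc k + d) = of_nat (Suc k + d) * (fact (k + d) :: rat)"
    "fact (Suc k) = of_nat (Suc k) * (fact k :: rat)"
    using k by (simp_all del: of_nat_Suc add: Suc_diff_le)
  have "(1 - (of_nat d / of_nat (Suc k)) ^ 2 :: rat) = (of_nat (Suc e) * of_nat (Suc k + d)) / (of_nat (Suc k))\<^sup>2"
    unfolding k by (simp add: field_simps power2_eq_square del: of_nat_Suc) (simp add: algebra_simps)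
  moreover have "of_nat (Suc e) \<noteq> (0 :: rat)" "of_nat (Suc k + d) \<noteq> (0 :: rat)" "of_nat (Suc k) \<noteq> (0 :: rat)"
    by (simp_all only: of_nat_eq_0_iff)
  ultimately show ?thesis
    using assms unfolding A [OF assms] A [OF le_SucI [OF assms]] f
    by (simp add: divide_simps power2_eq_square del: of_nat_Suc of_nat_add)
qed

text \<open>
  By \<open>central_choose_ratio_Suc\<close>, replacing \<open>k\<close> by \<open>m = k + 1\<close> changes the term for \<open>d\<close> by
  \<open>d / m\<^sup>2\<close> times the same ratio of binomial coefficients; the denominator \<open>d\<close> disappears, and the
  increments are summed by \<open>alternating_central_choose_sum\<close>.
\<close>

lemma alternating_choose_harmonic:
  "(\<Sum>d=1..k. (-1) ^ d / of_nat d * (of_nat ((2 * k) choose (k - d)) / of_nat ((2 * k) choose k))) =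
     (\<Sum>u=1..k. 1 / of_nat u) - (\<Sum>u=1..2*k. 1 / of_nat u :: rat)"
proof (induction k)
  case (Suc k)
  let ?r = "\<lambda>k d. of_nat ((2 * k) choose (k - d)) / of_nat ((2 * k) choose k) :: rat"
  let ?m = "Suc k"
  have "(\<Sum>d=1..k. (-1) ^ d / of_nat d * ?r k d) =
      (\<Sum>d=1..k. (-1) ^ d / of_nat d * ?r ?m d - (-1) ^ d * of_nat d * ?r ?m d / (of_nat ?m)\<^sup>2)"
  proof (intro sum.cong refl)
    fix d assume "d \<in> {1..k}"
    then have d: "d \<le> k" "of_nat d \<noteq> (0 :: rat)"
      by auto
    show "(-1) ^ d / of_nat d * ?r k d = (-1) ^ d / of_nat d * ?r ?m d - (-1) ^ d * of_nat d * ?r ?m d / (of_nat ?m)\<^sup>2"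
      unfolding central_choose_ratio_Suc [OF d(1)] using d(2)
      by (simp add: right_diff_distrib power_divide power2_eq_square del: of_nat_Suc binomial_Suc_Suc mult_Suc_right)
  qed
  also have "\<dots> = (\<Sum>d=1..?m. (-1) ^ d / of_nat d * ?r ?m d - (-1) ^ d * of_nat d * ?r ?m d / (of_nat ?m)\<^sup>2)"
    by (simp add: power2_eq_square del: of_nat_Suc binomial_Suc_Suc mult_Suc_right)
  also have "\<dots> = (\<Sum>d=1..?m. (-1) ^ d / of_nat d * ?r ?m d) - (\<Sum>d=1..?m. (-1) ^ d * of_nat d * ?r ?m d) / (of_nat ?m)\<^sup>2"
    by (simp only: sum_subtractf sum_divide_distrib)
  also have "(\<Sum>d=1..?m. (-1) ^ d * of_nat d * ?r ?m d) = - (of_nat ?m / (2 * (2 * of_nat ?m - 1)))"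
    by (rule alternating_central_choose_sum) simp
  finally have "(\<Sum>d=1..?m. (-1) ^ d / of_nat d * ?r ?m d) =
      (\<Sum>d=1..k. (-1) ^ d / of_nat d * ?r k d) - of_nat ?m / (2 * (2 * of_nat ?m - 1)) / (of_nat ?m)\<^sup>2"
    by simp
  also have "of_nat ?m / (2 * (2 * of_nat ?m - 1)) / (of_nat ?m)\<^sup>2 =
      1 / of_nat (2 * k + 1) + 1 / of_nat (2 * k + 2) - (1 / of_nat ?m :: rat)"
  proof -
    have "of_nat k + 1 \<noteq> (0 :: rat)" "2 * of_nat k + 1 \<noteq> (0 :: rat)"
      by (metis of_nat_Suc of_nat_neq_0 add.commute) (metis of_nat_Suc of_nat_neq_0 add.commute of_nat_mult of_nat_numeral)
    then show ?thesis
      by (simp add: divide_simps power2_eq_square) (simp add: algebra_simps)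
  qed
  finally show ?case
    unfolding Suc.IH by simp
qed simp

section \<open>Binomial coefficients and base-p digits\<close>

lemma prime_dvd_choose_mult:
  assumes "prime p" "\<not> p dvd i"
  shows "p dvd (p * a) choose i"
proof -
  obtain j where i: "i = Suc j"
    using assms(2) by (cases i) auto
  have "p dvd i * ((p * a) choose i)"
  proof (cases "p * a")
    case 0
    then show ?thesis
      by (simp only: i binomial_eq_0 zero_less_Suc mult_zero_right dvd_0_right)
  next
    case (Suc n)
    have "i * ((p * a) choose i) = (p * a) * (n choose j)"
      unfolding i Suc unfolding Suc_times_binomial_eq by (rule mult.commute)
    then show ?thesis
      by (simp only: mult.assoc dvd_triv_left)
  qed
  then show ?thesis
    using assms by (simp add: prime_dvd_mult_iff)
qed

lemma gauss_fact_block_cong: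
  assumes "prime p" "odd p" "r < p"
  shows "[gauss_fact p (p * a + r) = fact (p - 1) ^ a * (\<Prod>u=1..r. p * a + u)] (mod p\<^sup>2)"
  unfolding gauss_fact_block [OF assms(3)]
  by (rule cong_mult [OF gauss_fact_mult_cong [OF assms(1,2)] cong_refl])

lemma gauss_fact_block_cong_prime:
  assumes "prime p" "odd p" "r < p"
  shows "[gauss_fact p (p * a + r) = fact (p - 1) ^ a * fact r] (mod p)"
proof -
  have "[gauss_fact p (p * a + r) = fact (p - 1) ^ a * (\<Prod>u=1..r. p * a + u)] (mod p)"
    by (rule cong_dvd_modulus_nat [OF gauss_fact_block_cong [OF assms]]) simp
  moreover have "[(\<Prod>u=1..r. p * a + u) = (\<Prod>u=1..r. u)] (mod p)"
    by (intro cong_prod) (simp add: cong_def)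
  then have "[fact (p - 1) ^ a * (\<Prod>u=1..r. p * a + u) = fact (p - 1) ^ a * fact r] (mod p)"
    by (intro cong_mult cong_refl) (simp add: fact_prod)
  ultimately show ?thesis
    using cong_trans by blast
qed

lemma coprime_fact_prime: "prime p \<Longrightarrow> r < p \<Longrightarrow> coprime (fact r) (p :: nat)"
  using prime_imp_coprime [of p "fact r"] prime_dvd_fact_iff [of p r] by (simp add: coprime_commute)

text \<open>
  One digit of Lucas' theorem. Without a carry it follows from the formula with Gauss factorials.
  With a carry, that is for \<open>s > r\<close>, both sides vanish: in Vandermonde's expansion of the left side
  the factor \<open>(p a) choose i\<close> is divisible by \<open>p\<close> unless \<open>p\<close> divides \<open>i\<close>, and then the other
  factor is zero.
\<close>

lemma lucas_step:
  fixes p :: nat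
  assumes "prime p" "odd p" "r < p" "s < p"
  shows "[(p * a + r) choose (p * b + s) = (a choose b) * (r choose s)] (mod p)"
proof (cases "s \<le> r")
  case False
  have "p dvd ((p * a) choose i) * (r choose (p * b + s - i))" if i: "i \<le> p * b + s" for i
  proof (cases "p dvd i")
    case True
    then obtain c where c: "i = p * c"
      by blast
    have "p * c < p * Suc b"
      using i assms c by simp
    then have "c \<le> b"
      using assms(3) by (simp only: mult_less_cancel1) simp
    then have "p * c \<le> p * b"
      by simp
    then have "p * b + s - i \<ge> s"
      unfolding c by linarith
    then have "r choose (p * b + s - i) = 0"
      using False by (intro binomial_eq_0) simp
    then show ?thesis
      by (simp only: mult_zero_right dvd_0_right)
  next
    case False
    then show ?thesis
      using prime_dvd_choose_mult [OF assms(1)] by simp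
  qed
  then have "p dvd (p * a + r) choose (p * b + s)"
    unfolding vandermonde [symmetric] by (intro dvd_sum) auto
  moreover have "r choose s = 0"
    using False by (intro binomial_eq_0) simp
  ultimately show ?thesis
    by (simp only: mult_zero_right cong_0_iff)
next
  case sr: True
  show ?thesis
  proof (cases "b \<le> a")
    case False
    then have "p * Suc a \<le> p * b"
      by (intro mult_le_mono2) simp
    then have "(p * a + r) choose (p * b + s) = 0"
      using assms by (intro binomial_eq_0) simp
    moreover have "a choose b = 0"
      using False by (intro binomial_eq_0) simp
    ultimately show ?thesis
      by (simp only: mult_zero_left cong_refl)
  next
    case True
    let ?c = "(p * a + r) choose (p * b + s)" and ?w = "fact (p - 1) :: nat"
    have w: "?w ^ b * ?w ^ (a - b) = ?w ^ a"
      using True by (simp flip: power_add)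
    have "[?c * (gauss_fact p (p * b + s) * gauss_fact p (p * (a - b) + (r - s))) =
        ?c * ((?w ^ b * fact s) * (?w ^ (a - b) * fact (r - s)))] (mod p)"
      using assms by (intro cong_mult cong_refl gauss_fact_block_cong_prime) auto
    moreover have "[(a choose b) * gauss_fact p (p * a + r) = (a choose b) * (?w ^ a * fact r)] (mod p)"
      using assms by (intro cong_mult cong_refl gauss_fact_block_cong_prime) auto
    ultimately have "[?c * ((?w ^ b * fact s) * (?w ^ (a - b) * fact (r - s))) = (a choose b) * (?w ^ a * fact r)] (mod p)"
      unfolding choose_gauss_fact [OF assms(1) sr assms(3) True] using cong_sym cong_trans by blast
    also have "?c * ((?w ^ b * fact s) * (?w ^ (a - b) * fact (r - s))) = ?w ^ a * fact s * fact (r - s) * ?c"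
      unfolding w [symmetric] by (simp only: mult_ac)
    also have "(a choose b) * (?w ^ a * fact r) = ?w ^ a * fact s * fact (r - s) * ((a choose b) * (r choose s))"
      unfolding binomial_fact_lemma [OF sr, symmetric] by (simp only: mult_ac)
    finally have cong: "[?w ^ a * fact s * fact (r - s) * ?c = ?w ^ a * fact s * fact (r - s) * ((a choose b) * (r choose s))] (mod p)" .
    have "coprime (?w ^ a * fact s * fact (r - s)) p"
      using assms by (simp add: coprime_fact_prime prime_gt_0_nat)
    from cong_mult_lcancel_nat [OF this] cong show ?thesis
      by blast
  qed
qed

lemma choose_prime_minus_one_cong:
  assumes "prime p" "j < p"
  shows "[int ((p - 1) choose j) = (-1) ^ j] (mod int p)"
  using assms(2)
proof (induction j)
  case (Suc j)
  obtain n where n: "p = Suc n"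
    using Suc.prems by (cases p) auto
  have "int p dvd int (p choose Suc j)"
    using prime_dvd_choose_mult [OF assms(1), of "Suc j" 1] Suc.prems by (simp add: nat_dvd_not_less)
  then have "[int (p choose Suc j) - int ((p - 1) choose j) = 0 - (-1) ^ j] (mod int p)"
    using Suc by (intro cong_diff) (auto simp: cong_0_iff)
  then show ?case
    by (simp add: n)
qed simp


section \<open>Binomial coefficients at multiples of (q - 1) / 4\<close>

text \<open>
  For \<open>p = 4 k + 1\<close> this is the number with \<open>s\<close> digits in base \<open>p\<close> all of which are \<open>k\<close>.
\<close>

definition quarter :: "nat \<Rightarrow> nat \<Rightarrow> nat" where
  "quarter p s = (p ^ s - 1) div 4"

context
  fixes p k :: nat
  assumes p: "prime p" and pk: "p = 4 * k + 1"
begin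

lemma prime_1_mod_4_index_pos: "k > 0" 
  using prime_gt_1_nat [OF p] pk by simp

lemma prime_1_mod_4_odd: "odd p"
  using pk by simp

lemma quarter_Suc: "quarter p (Suc s) = p * quarter p s + k" and quarter_eq: "4 * quarter p s + 1 = p ^ s"
proof -
  have *: "4 * quarter p s + 1 = p ^ s" for s
  proof -
    have "[p ^ s = 1 ^ s] (mod 4)"
      unfolding pk by (intro cong_pow) (simp add: cong_def)
    moreover have "p ^ s > 0"
      unfolding pk by simp
    ultimately have "4 dvd p ^ s - 1"
      by (simp add: cong_altdef_nat)
    then show ?thesis
      using \<open>p ^ s > 0\<close> unfolding quarter_def by simp
  qed
  show "4 * quarter p s + 1 = p ^ s"
    by fact
  have "4 * quarter p (Suc s) + 1 = p * (4 * quarter p s + 1)"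
    unfolding * by simp
  then show "quarter p (Suc s) = p * quarter p s + k"
    using pk by (simp add: algebra_simps)
qed

lemma quarter_0: "quarter p 0 = 0"
  by (simp add: quarter_def)

lemma quarter_pos: "quarter p (Suc s) > 0"
  unfolding quarter_Suc using prime_1_mod_4_index_pos by simp

lemma absorb_multiple_quarter:
  assumes "l > 0"
  shows "l * ((2 * p * quarter p (Suc s)) choose (l * quarter p (Suc s))) =
    2 * p * ((2 * p * quarter p (Suc s) - 1) choose (l * quarter p (Suc s) - 1))"
proof -
  let ?N = "quarter p (Suc s)"
  have N: "?N > 0"
    by (rule quarter_pos)
  then obtain n j where n: "2 * p * ?N = Suc n" and j: "l * ?N = Suc j"
    using p assms by (metis mult_pos_pos not0_implies_Suc not_gr_zero pos2 prime_gt_0_nat)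
  have "(l * ?N) * (Suc n choose Suc j) = (2 * p * ?N) * (n choose j)"
    unfolding n j unfolding Suc_times_binomial_eq by (rule mult.commute)
  then have "?N * (l * (Suc n choose Suc j)) = ?N * (2 * p * (n choose j))"
    by (simp only: mult_ac)
  then show ?thesis
    using N unfolding n j by simp
qed

text \<open>
  The carry out of the last digit accounts for one factor \<open>p\<close>, made explicit by
  \<open>absorb_multiple_quarter\<close>. The digits above it are \<open>3 k\<close> in the lower index and at most \<open>2 k\<close>
  in the upper one, which gives another carry.
\<close>

lemma choose_three_quarter_dvd:
  assumes "c < 2 * k"
  shows "p\<^sup>2 dvd (2 * p * quarter p (Suc (Suc s))) choose ((4 * c + 3) * quarter p (Suc (Suc s)))"
proof -
  let ?N = "quarter p (Suc (Suc s))" and ?N' = "quarter p (Suc s)" and ?N'' = "quarter p s"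
  have k: "k > 0" by (rule prime_1_mod_4_index_pos)
  have 1: "2 * p * ?N - 1 = p * (2 * ?N - 1) + (p - 1)"
  proof -
    obtain n where "?N = Suc n"
      using quarter_pos not0_implies_Suc by blast
    then show ?thesis
      using pk by (simp add: algebra_simps)
  qed
  have 2: "2 * ?N - 1 = p * (2 * ?N') + (2 * k - 1)"
    using k unfolding quarter_Suc [of "Suc s"] by simp
  have 3: "(4 * c + 3) * ?N - 1 = p * (p * (c * p ^ s + 3 * ?N'') + 3 * k) + (3 * k - c - 1)"
  proof -
    have "(4 * c + 3) * ?N + c = c * (4 * ?N + 1) + 3 * ?N"
      by (simp add: algebra_simps)
    also have "\<dots> = c * p ^ Suc (Suc s) + 3 * (p * (p * ?N'' + k) + k)"
      unfolding quarter_eq by (simp only: quarter_Suc)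
    finally have "(4 * c + 3) * ?N + c = p * (p * (c * p ^ s + 3 * ?N'') + 3 * k) + 3 * k"
      by (simp add: algebra_simps)
    then show ?thesis
      using assms by simp
  qed
  have cong1: "[(2 * p * ?N - 1) choose ((4 * c + 3) * ?N - 1) =
      ((2 * ?N - 1) choose (p * (c * p ^ s + 3 * ?N'') + 3 * k)) * ((p - 1) choose (3 * k - c - 1))] (mod p)"
    unfolding 1 3 using pk k by (intro lucas_step p prime_1_mod_4_odd) auto
  have "[(2 * ?N - 1) choose (p * (c * p ^ s + 3 * ?N'') + 3 * k) =
      ((2 * ?N') choose (c * p ^ s + 3 * ?N'')) * ((2 * k - 1) choose (3 * k))] (mod p)"
    unfolding 2 using pk k by (intro lucas_step p prime_1_mod_4_odd) auto
  moreover have "(2 * k - 1) choose (3 * k) = 0"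
    using k by (intro binomial_eq_0) simp
  ultimately have "p dvd (2 * ?N - 1) choose (p * (c * p ^ s + 3 * ?N'') + 3 * k)"
    by (simp only: mult_zero_right cong_0_iff)
  then have "p dvd ((2 * ?N - 1) choose (p * (c * p ^ s + 3 * ?N'') + 3 * k)) * ((p - 1) choose (3 * k - c - 1))"
    by (rule dvd_mult2)
  then have "p dvd (2 * p * ?N - 1) choose ((4 * c + 3) * ?N - 1)"
    using cong_dvd_iff [OF cong1] by blast
  then have "p * p dvd (2 * p) * ((2 * p * ?N - 1) choose ((4 * c + 3) * ?N - 1))"
    by (intro mult_dvd_mono) auto
  then have "p\<^sup>2 dvd (4 * c + 3) * ((2 * p * ?N) choose ((4 * c + 3) * ?N))"
    using absorb_multiple_quarter [of "4 * c + 3" "Suc s"] by (simp add: power2_eq_square)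
  moreover have "coprime p (4 * c + 3)"
  proof (rule prime_imp_coprime [OF p], rule notI)
    assume "p dvd 4 * c + 3"
    then obtain e where e: "4 * c + 3 = p * e"
      by blast
    have "4 * c + 3 < p * 2"
      using assms pk by simp
    then have "p * e < p * 2"
      unfolding e .
    then have "e = 0 \<or> e = 1"
      by simp linarith
    then show False
      using e unfolding pk by (elim disjE; simp) presburger
  qed
  then have "coprime (p\<^sup>2) (4 * c + 3)"
    by simp
  ultimately show ?thesis
    using coprime_dvd_mult_right_iff by blast
qed

lemma choose_shifted_quarter_cong:
  assumes "c < p"
  shows "[(2 * quarter p (Suc s)) choose (c * p ^ s + quarter p s) = ((2 * k) choose k) ^ s * ((2 * k) choose c)] (mod p)"
proof (induction s)
  case 0
  show ?case
    by (simp add: quarter_0 quarter_Suc [of 0, simplified])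
next
  case (Suc s)
  have eq: "2 * quarter p (Suc (Suc s)) = p * (2 * quarter p (Suc s)) + 2 * k"
    "c * p ^ Suc s + quarter p (Suc s) = p * (c * p ^ s + quarter p s) + k"
    by (simp_all add: quarter_Suc algebra_simps)
  have "[(2 * quarter p (Suc (Suc s))) choose (c * p ^ Suc s + quarter p (Suc s)) =
      ((2 * quarter p (Suc s)) choose (c * p ^ s + quarter p s)) * ((2 * k) choose k)] (mod p)"
    unfolding eq using pk by (intro lucas_step p prime_1_mod_4_odd) auto
  moreover have "[((2 * quarter p (Suc s)) choose (c * p ^ s + quarter p s)) * ((2 * k) choose k) =
      ((2 * k) choose k) ^ s * ((2 * k) choose c) * ((2 * k) choose k)] (mod p)"
    by (intro cong_mult Suc.IH cong_refl)
  ultimately have "[(2 * quarter p (Suc (Suc s))) choose (c * p ^ Suc s + quarter p (Suc s)) =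
      ((2 * k) choose k) ^ s * ((2 * k) choose c) * ((2 * k) choose k)] (mod p)"
    by (rule cong_trans)
  then show ?case
    unfolding power_Suc by (simp only: mult_ac)
qed

text \<open>
  The digits of the lower index are \<open>k - c - 1\<close>, then only \<open>k\<close>, and finally \<open>c\<close>; those of the upper
  index are \<open>p - 1\<close>, \<open>2 k - 1\<close> and then only \<open>2 k\<close>.
\<close>

lemma choose_one_quarter_lucas:
  assumes "c < k"
  shows "[(2 * p * quarter p (Suc (Suc s)) - 1) choose ((4 * c + 1) * quarter p (Suc (Suc s)) - 1) =
    (((2 * k) choose k) ^ s * ((2 * k) choose c)) * ((2 * k - 1) choose k) * ((p - 1) choose (k - c - 1))] (mod p)"
proof -
  let ?N = "quarter p (Suc (Suc s))" and ?N' = "quarter p (Suc s)" and ?N'' = "quarter p s"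
  have k: "k > 0" by (rule prime_1_mod_4_index_pos)
  have 1: "2 * p * ?N - 1 = p * (2 * ?N - 1) + (p - 1)"
  proof -
    obtain n where "?N = Suc n"
      using quarter_pos not0_implies_Suc by blast
    then show ?thesis
      using pk by (simp add: algebra_simps)
  qed
  have 2: "2 * ?N - 1 = p * (2 * ?N') + (2 * k - 1)"
    using k unfolding quarter_Suc [of "Suc s"] by simp
  have 3: "(4 * c + 1) * ?N - 1 = p * (p * (c * p ^ s + ?N'') + k) + (k - c - 1)"
  proof -
    have "(4 * c + 1) * ?N + c = c * (4 * ?N + 1) + ?N"
      by (simp add: algebra_simps)
    also have "\<dots> = c * p ^ Suc (Suc s) + (p * (p * ?N'' + k) + k)"
      unfolding quarter_eq by (simp only: quarter_Suc)
    finally have "(4 * c + 1) * ?N + c = p * (p * (c * p ^ s + ?N'') + k) + k"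
      by (simp add: algebra_simps)
    then show ?thesis
      using assms by simp
  qed
  have "[(2 * p * ?N - 1) choose ((4 * c + 1) * ?N - 1) =
      ((2 * ?N - 1) choose (p * (c * p ^ s + ?N'') + k)) * ((p - 1) choose (k - c - 1))] (mod p)"
    unfolding 1 3 using pk k by (intro lucas_step p prime_1_mod_4_odd) auto
  moreover have "[(2 * ?N - 1) choose (p * (c * p ^ s + ?N'') + k) =
      ((2 * ?N') choose (c * p ^ s + ?N'')) * ((2 * k - 1) choose k)] (mod p)"
    unfolding 2 using pk k by (intro lucas_step p prime_1_mod_4_odd) auto
  then have "[((2 * ?N - 1) choose (p * (c * p ^ s + ?N'') + k)) * ((p - 1) choose (k - c - 1)) =
      ((2 * ?N') choose (c * p ^ s + ?N'')) * ((2 * k - 1) choose k) * ((p - 1) choose (k - c - 1))] (mod p)"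
    by (intro cong_mult cong_refl)
  moreover have "[((2 * ?N') choose (c * p ^ s + ?N'')) * ((2 * k - 1) choose k) * ((p - 1) choose (k - c - 1)) =
      (((2 * k) choose k) ^ s * ((2 * k) choose c)) * ((2 * k - 1) choose k) * ((p - 1) choose (k - c - 1))] (mod p)"
    using assms pk by (intro cong_mult cong_refl choose_shifted_quarter_cong) auto
  ultimately show ?thesis
    using cong_trans by blast
qed

end

context
  fixes p k :: nat
  assumes p: "prime p" and pk: "p = 4 * k + 1"
begin

text \<open>
  Since \<open>quarter p (Suc s)\<close> is \<open>k\<close> modulo \<open>p\<close>, the incomplete blocks that arise when the last digit
  is split off are the same, modulo \<open>p\<^sup>2\<close>, as those for the two-digit number \<open>p k + k\<close>. So each
  additional digit contributes the same factor.
\<close>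

lemma choose_central_quarter_step:
  "[((2 * quarter p (Suc (Suc s))) choose quarter p (Suc (Suc s))) * (gauss_fact p (p * k + k))\<^sup>2 =
    ((2 * quarter p (Suc s)) choose quarter p (Suc s)) * gauss_fact p (2 * (p * k + k))] (mod p\<^sup>2)"
proof -
  let ?N = "quarter p (Suc (Suc s))" and ?M = "quarter p (Suc s)" and ?w = "fact (p - 1) :: nat"
  let ?V = "\<Prod>u=1..k. p * k + u" and ?U = "\<Prod>u=1..2*k. p * (2 * k) + u"
  have odd: "odd p"
    using pk by simp
  have Mk: "[p * ?M = p * k] (mod p\<^sup>2)" 
  proof -
    have "p * ?M = p * k + p\<^sup>2 * quarter p s"
      unfolding quarter_Suc [OF p pk] by (simp add: power2_eq_square algebra_simps)
    then show ?thesis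
      by (simp add: cong_def)
  qed
  have gM: "[gauss_fact p (p * ?M + k) = ?w ^ ?M * ?V] (mod p\<^sup>2)"
  proof -
    have "[(\<Prod>u=1..k. p * ?M + u) = ?V] (mod p\<^sup>2)"
      by (intro cong_prod cong_add Mk cong_refl)
    then have "[?w ^ ?M * (\<Prod>u=1..k. p * ?M + u) = ?w ^ ?M * ?V] (mod p\<^sup>2)"
      by (intro cong_mult cong_refl)
    then show ?thesis
      using gauss_fact_block_cong [OF p odd, of k ?M] pk cong_trans by fastforce
  qed
  have gM2: "[gauss_fact p (p * (2 * ?M) + 2 * k) = ?w ^ (2 * ?M) * ?U] (mod p\<^sup>2)"
  proof -
    have "[p * (2 * ?M) = p * (2 * k)] (mod p\<^sup>2)"
      using cong_mult [OF cong_refl [of 2] Mk] by (simp only: mult.left_commute)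
    then have "[(\<Prod>u=1..2*k. p * (2 * ?M) + u) = ?U] (mod p\<^sup>2)"
      by (intro cong_prod cong_add cong_refl)
    then have "[?w ^ (2 * ?M) * (\<Prod>u=1..2*k. p * (2 * ?M) + u) = ?w ^ (2 * ?M) * ?U] (mod p\<^sup>2)"
      by (intro cong_mult cong_refl)
    then show ?thesis
      using gauss_fact_block_cong [OF p odd, of "2 * k" "2 * ?M"] pk cong_trans by fastforce
  qed
  have gk: "[gauss_fact p (p * k + k) = ?w ^ k * ?V] (mod p\<^sup>2)"
    using gauss_fact_block_cong [OF p odd, of k k] pk by simp
  have gk2: "[gauss_fact p (2 * (p * k + k)) = ?w ^ (2 * k) * ?U] (mod p\<^sup>2)"
    using gauss_fact_block_cong [OF p odd, of "2 * k" "2 * k"] pk by (simp add: algebra_simps)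
  let ?C = "(2 * ?N) choose ?N" and ?D = "(2 * ?M) choose ?M"
  have N: "2 * ?N = p * (2 * ?M) + 2 * k" "p * ?M + k = ?N"
    by (simp_all add: quarter_Suc [OF p pk, of "Suc s"])
  have diff: "2 * ?M - ?M = ?M" "2 * k - k = k"
    by simp_all
  have "k \<le> 2 * k" "2 * k < p" "?M \<le> 2 * ?M"
    using pk by simp_all
  from choose_gauss_fact [OF p this]
  have eq: "?C * (gauss_fact p (p * ?M + k) * gauss_fact p (p * ?M + k)) = ?D * gauss_fact p (p * (2 * ?M) + 2 * k)"
    by (simp only: N diff)
  have c1: "[?C * (gauss_fact p (p * ?M + k) * gauss_fact p (p * ?M + k)) =
      ?C * ((?w ^ ?M * ?V) * (?w ^ ?M * ?V))] (mod p\<^sup>2)"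
    by (rule cong_mult [OF cong_refl cong_mult [OF gM gM]])
  have c2: "[?D * gauss_fact p (p * (2 * ?M) + 2 * k) = ?D * (?w ^ (2 * ?M) * ?U)] (mod p\<^sup>2)"
    by (rule cong_scalar_left [OF gM2])
  have "[?C * ((?w ^ ?M * ?V) * (?w ^ ?M * ?V)) = ?D * (?w ^ (2 * ?M) * ?U)] (mod p\<^sup>2)"
    by (rule cong_trans [OF cong_sym [OF c1]]) (unfold eq, rule c2)
  moreover have "?C * ((?w ^ ?M * ?V) * (?w ^ ?M * ?V)) = ?w ^ (2 * ?M) * (?C * ?V\<^sup>2)"
    unfolding power2_eq_square mult_2 power_add by (simp only: mult_ac)
  moreover have "?D * (?w ^ (2 * ?M) * ?U) = ?w ^ (2 * ?M) * (?D * ?U)"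
    by (simp only: mult_ac)
  moreover have w: "coprime ?w (p\<^sup>2)"
    using coprime_fact_prime [OF p, of "p - 1"] prime_gt_0_nat [OF p] by simp
  then have "coprime (?w ^ (2 * ?M)) (p\<^sup>2)"
    by simp
  ultimately have CD: "[?C * ?V\<^sup>2 = ?D * ?U] (mod p\<^sup>2)"
    using cong_mult_lcancel_nat by metis
  have "[?C * (gauss_fact p (p * k + k))\<^sup>2 = ?C * (?w ^ k * ?V)\<^sup>2] (mod p\<^sup>2)"
    by (intro cong_mult cong_pow cong_refl gk)
  also have "?C * (?w ^ k * ?V)\<^sup>2 = ?w ^ (2 * k) * (?C * ?V\<^sup>2)"
    by (simp add: power_mult_distrib mult_ac flip: power_mult)
  also have "[\<dots> = ?w ^ (2 * k) * (?D * ?U)] (mod p\<^sup>2)"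
    by (intro cong_mult cong_refl CD)
  also have "?w ^ (2 * k) * (?D * ?U) = ?D * (?w ^ (2 * k) * ?U)"
    by (simp only: mult_ac)
  also have "[\<dots> = ?D * gauss_fact p (2 * (p * k + k))] (mod p\<^sup>2)"
    by (intro cong_mult cong_refl cong_sym [OF gk2])
  finally show ?thesis .
qed

lemma choose_central_quarter_cong:
  "[((2 * quarter p (Suc s)) choose quarter p (Suc s)) * (gauss_fact p (p * k + k)) ^ (2 * s) =
    ((2 * k) choose k) * gauss_fact p (2 * (p * k + k)) ^ s] (mod p\<^sup>2)"
proof (induction s)
  case 0
  then show ?case
    by (simp add: quarter_0 [OF p pk] quarter_Suc [OF p pk, of 0])
next
  case (Suc s)
  let ?X = "gauss_fact p (p * k + k)" and ?Y = "gauss_fact p (2 * (p * k + k))"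
  let ?C = "\<lambda>s. (2 * quarter p (Suc s)) choose quarter p (Suc s)"
  have "?C (Suc s) * ?X ^ (2 * Suc s) = (?C (Suc s) * ?X\<^sup>2) * ?X ^ (2 * s)"
    by (simp add: power2_eq_square mult_ac)
  also have "[\<dots> = (?C s * ?Y) * ?X ^ (2 * s)] (mod p\<^sup>2)"
    by (intro cong_mult cong_refl choose_central_quarter_step)
  also have "(?C s * ?Y) * ?X ^ (2 * s) = (?C s * ?X ^ (2 * s)) * ?Y"
    by (simp only: mult_ac)
  also have "[\<dots> = (((2 * k) choose k) * ?Y ^ s) * ?Y] (mod p\<^sup>2)"
    by (intro cong_mult cong_refl Suc.IH)
  also have "(((2 * k) choose k) * ?Y ^ s) * ?Y = ((2 * k) choose k) * ?Y ^ Suc s"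
    by (simp only: power_Suc mult_ac)
  finally show ?case .
qed

text \<open>
  After \<open>p - 2\<close> steps the two Gauss factorials occur with exponents \<open>2 (p - 2)\<close> and \<open>p - 2\<close>. Two more
  factors of the first and one of the second make the exponents \<open>2 (p - 1)\<close> and \<open>p - 1\<close>; the latter
  power is trivial by \<open>gauss_fact_half_power_cong\<close>. The additional factors are compared by expanding
  their incomplete blocks to first order in \<open>p\<close>, which produces the harmonic numbers.
\<close>

lemma choose_central_quarter_harmonic:
  defines "x \<equiv> of_nat (gauss_fact p (p * k + k)) ^ (p - 1) :: rat"
    and "\<Delta> \<equiv> (\<Sum>u=1..2*k. 1 / of_nat u) - (\<Sum>u=1..k. 1 / of_nat u) :: rat"
  shows "pcong p 2 (of_nat ((2 * quarter p (p - 1)) choose quarter p (p - 1)) * x\<^sup>2)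
    (1 - 2 * of_nat p * of_nat k * \<Delta>)"
proof -
  let ?X = "gauss_fact p (p * k + k)" and ?Y = "gauss_fact p (2 * (p * k + k))"
  let ?w = "fact (p - 1) :: nat"
  let ?V = "\<Prod>u=1..k. p * k + u" and ?U = "\<Prod>u=1..2*k. p * (2 * k) + u"
  let ?C = "(2 * quarter p (p - 1)) choose quarter p (p - 1)" and ?c = "(2 * k) choose k"
  have odd: "odd p" and k0: "k > 0"
    using pk prime_1_mod_4_index_pos [OF p pk] by simp_all
  have s: "Suc (p - 2) = p - 1" "Suc (p - 1) = p"
    using pk k0 by simp_all
  have "[?C * ?X ^ (2 * (p - 2)) = ?c * ?Y ^ (p - 2)] (mod p\<^sup>2)"
    using choose_central_quarter_cong [of "p - 2"] unfolding s .
  then have "[?X\<^sup>2 * ?Y * (?C * ?X ^ (2 * (p - 2))) = ?X\<^sup>2 * ?Y * (?c * ?Y ^ (p - 2))] (mod p\<^sup>2)"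
    by (rule cong_scalar_left)
  moreover have "?X\<^sup>2 * ?Y * (?C * ?X ^ (2 * (p - 2))) = ?C * (?X ^ (p - 1))\<^sup>2 * ?Y"
  proof -
    have "?X\<^sup>2 * ?X ^ (2 * (p - 2)) = ?X ^ (2 + 2 * (p - 2))"
      by (rule power_add [symmetric])
    also have "2 + 2 * (p - 2) = (p - 1) * 2"
      using s by simp
    finally have sq: "?X\<^sup>2 * ?X ^ (2 * (p - 2)) = (?X ^ (p - 1))\<^sup>2"
      unfolding power_mult .
    have "?X\<^sup>2 * ?Y * (?C * ?X ^ (2 * (p - 2))) = ?C * (?X\<^sup>2 * ?X ^ (2 * (p - 2))) * ?Y"
      by (simp only: mult_ac)
    then show ?thesis
      unfolding sq .
  qed
  moreover have "?X\<^sup>2 * ?Y * (?c * ?Y ^ (p - 2)) = ?c * ?X\<^sup>2 * ?Y ^ (p - 1)"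
    unfolding s(1) [symmetric] by (simp only: power_Suc mult_ac)
  moreover have "[?Y ^ (p - 1) = 1] (mod p\<^sup>2)"
  proof -
    have "p\<^sup>2 = 2 * (2 * (p * k + k)) + 1"
      unfolding pk by (simp add: power2_eq_square algebra_simps)
    from gauss_fact_half_power_cong [OF p odd this] show ?thesis
      by (metis cong_int_iff of_nat_1 of_nat_power)
  qed
  then have "[?c * ?X\<^sup>2 * ?Y ^ (p - 1) = ?c * ?X\<^sup>2 * 1] (mod p\<^sup>2)"
    by (intro cong_mult cong_refl)
  ultimately have 1: "[?C * (?X ^ (p - 1))\<^sup>2 * ?Y = ?c * ?X\<^sup>2] (mod p\<^sup>2)"
    by (simp only: mult_1_right) (rule cong_trans)
  have gk: "[?X = ?w ^ k * ?V] (mod p\<^sup>2)"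
    using gauss_fact_block_cong [OF p odd, of k k] pk by simp
  have gk2: "[?Y = ?w ^ (2 * k) * ?U] (mod p\<^sup>2)"
    using gauss_fact_block_cong [OF p odd, of "2 * k" "2 * k"] pk by (simp add: algebra_simps)
  have c1: "[?C * (?X ^ (p - 1))\<^sup>2 * ?Y = ?C * (?X ^ (p - 1))\<^sup>2 * (?w ^ (2 * k) * ?U)] (mod p\<^sup>2)"
    by (rule cong_scalar_left [OF gk2])
  have c2: "[?c * ?X\<^sup>2 = ?c * (?w ^ k * ?V)\<^sup>2] (mod p\<^sup>2)"
    by (rule cong_scalar_left [OF cong_pow [OF gk]])
  have "[?C * (?X ^ (p - 1))\<^sup>2 * (?w ^ (2 * k) * ?U) = ?c * (?w ^ k * ?V)\<^sup>2] (mod p\<^sup>2)"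
    by (rule cong_trans [OF cong_sym [OF c1] cong_trans [OF 1 c2]])
  moreover have e1: "?c * (?w ^ k * ?V)\<^sup>2 = ?w ^ (2 * k) * (?c * ?V\<^sup>2)"
    unfolding power2_eq_square mult_2 power_add by (simp only: mult_ac)
  moreover have e2: "?C * (?X ^ (p - 1))\<^sup>2 * (?w ^ (2 * k) * ?U) = ?w ^ (2 * k) * (?C * (?X ^ (p - 1))\<^sup>2 * ?U)"
    by (simp only: mult_ac)
  ultimately have "[?w ^ (2 * k) * (?C * (?X ^ (p - 1))\<^sup>2 * ?U) = ?w ^ (2 * k) * (?c * ?V\<^sup>2)] (mod p\<^sup>2)"
    by (simp only: e1 e2)
  moreover have "coprime (?w ^ (2 * k)) (p\<^sup>2)"
    using coprime_fact_prime [OF p, of "p - 1"] prime_gt_0_nat [OF p] by simp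
  ultimately have 2: "[?C * (?X ^ (p - 1))\<^sup>2 * ?U = ?c * ?V\<^sup>2] (mod p\<^sup>2)"
    using cong_mult_lcancel_nat by metis
  have prod: "pcong p 2 (of_nat (\<Prod>u=1..r. p * a + u)) (of_nat (fact r) * (1 + of_nat p * (of_nat a * (\<Sum>u=1..r. 1 / of_nat u))))"
    if "r < p" for a r
  proof -
    have A: "(of_nat (\<Prod>u=1..r. p * a + u) :: rat) = of_nat (fact r) * (\<Prod>u=1..r. 1 + of_nat p * (of_nat a / of_nat u))"
      unfolding fact_prod of_nat_prod of_nat_id prod.distrib [symmetric]
      by (intro prod.cong refl) (auto simp: field_simps)
    have B: "pcong p 2 (\<Prod>u=1..r. 1 + of_nat p * (of_nat a / of_nat u)) (1 + of_nat p * (\<Sum>u=1..r. of_nat a / of_nat u))"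
      using that by (intro pcong_prod_one_plus p p_integral_divide) (auto simp: p nat_dvd_not_less)
    have C: "(\<Sum>u=1..r. of_nat a / of_nat u) = (of_nat a * (\<Sum>u=1..r. 1 / of_nat u) :: rat)"
      by (simp add: sum_distrib_left)
    show ?thesis
      unfolding A C [symmetric] by (intro pcong_mult_left p p_integral_of_nat B)
  qed
  let ?H = "\<lambda>r. \<Sum>u=1..r. 1 / of_nat u :: rat"
  have H: "p_integral p (?H r)" if "r < p" for r
    using that by (intro p_integral_sum p_integral_divide p) (auto simp: p nat_dvd_not_less)
  note int = p_integral_add [OF p] p_integral_mult [OF p] p_integral_diff [OF p] p_integral_power [OF p]
    p_integral_of_nat [OF p] p_integral_numeral [OF p] H
  have k2: "2 * k < p" "k < p"
    using pk by auto
  have 3: "pcong p 2 (of_nat (?C * (?X ^ (p - 1))\<^sup>2 * ?U)) (of_nat (?c * ?V\<^sup>2))"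
    using 2 pcong_of_nat_iff [OF p] by blast
  \<comment> \<open>the factorials in both blocks amount to \<open>(2 k)!\<close>, a unit at \<open>p\<close>\<close>
  let ?f = "of_nat (fact (2 * k)) :: rat"
  have r1: "pcong p 2 ((of_nat ?C * x\<^sup>2) * of_nat ?U) ((of_nat ?C * x\<^sup>2) * (?f * (1 + of_nat p * (of_nat (2 * k) * ?H (2 * k)))))"
    unfolding x_def by (intro pcong_mult_left p prod k2 int)
  have r2: "(of_nat ?C * x\<^sup>2) * of_nat ?U = of_nat (?C * (?X ^ (p - 1))\<^sup>2 * ?U)"
    unfolding x_def by simp
  have r3: "pcong p 2 (of_nat ?c * (of_nat ?V * of_nat ?V)) (of_nat ?c *
      ((of_nat (fact k) * (1 + of_nat p * (of_nat k * ?H k))) * (of_nat (fact k) * (1 + of_nat p * (of_nat k * ?H k)))))"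
    by (intro pcong_mult_left pcong_mult p prod k2 int)
  have r4: "of_nat ?c * (of_nat ?V * of_nat ?V) = (of_nat (?c * ?V\<^sup>2) :: rat)"
    by (simp add: power2_eq_square)
  have r5: "of_nat ?c *
      ((of_nat (fact k) * (1 + of_nat p * (of_nat k * ?H k))) * (of_nat (fact k) * (1 + of_nat p * (of_nat k * ?H k)))) =
      ?f * ((1 + of_nat p * (of_nat k * ?H k)) * (1 + of_nat p * (of_nat k * ?H k)))"
  proof -
    have "fact k * fact k * ?c = fact (2 * k)"
      using binomial_fact_lemma [of k "2 * k"] by simp
    then have "?f = of_nat (fact k * fact k * ?c)"
      by simp
    then show ?thesis
      by (simp only: of_nat_mult mult_ac)
  qed
  note pcong_trans [OF p pcong_sym [OF p r1 [unfolded r2]] pcong_trans [OF p 3 r3 [unfolded r4 r5]]]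
  then have "pcong p 2 (?f * ((of_nat ?C * x\<^sup>2) * (1 + of_nat p * (of_nat (2 * k) * ?H (2 * k)))))
      (?f * ((1 + of_nat p * (of_nat k * ?H k)) * (1 + of_nat p * (of_nat k * ?H k))))"
    by (simp only: mult.left_commute)
  moreover have "\<not> p dvd fact (2 * k)"
    using k2 p by (simp add: prime_dvd_fact_iff)
  ultimately have 4: "pcong p 2 ((of_nat ?C * x\<^sup>2) * (1 + of_nat p * (of_nat (2 * k) * ?H (2 * k))))
      ((1 + of_nat p * (of_nat k * ?H k)) * (1 + of_nat p * (of_nat k * ?H k)))"
    using pcong_cancel [OF p] by blast
  \<comment> \<open>the inverse modulo \<open>p\<^sup>2\<close> of the factor to be moved to the other side\<close>
  let ?e = "1 - of_nat p * (of_nat (2 * k) * ?H (2 * k))"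
  have 5: "pcong p 2 (?e * ((of_nat ?C * x\<^sup>2) * (1 + of_nat p * (of_nat (2 * k) * ?H (2 * k)))))
      (?e * ((1 + of_nat p * (of_nat k * ?H k)) * (1 + of_nat p * (of_nat k * ?H k))))"
    using 4 by (intro pcong_mult_left p int k2)
  \<comment> \<open>used below with the explicit cofactor \<open>z\<close> of \<open>p\<^sup>2\<close> in a difference of polynomials in \<open>p\<close>\<close>
  have sq: "pcong p 2 a b" if "a - b = of_nat p * of_nat p * z" "p_integral p z" for a b z
    unfolding pcong_def using that by (intro exI [of _ z]) (simp add: power2_eq_square)
  have 6: "pcong p 2 (of_nat ?C * x\<^sup>2) (?e * ((of_nat ?C * x\<^sup>2) * (1 + of_nat p * (of_nat (2 * k) * ?H (2 * k)))))"
    by (rule sq [where z = "(of_nat ?C * x\<^sup>2) * (of_nat (2 * k) * ?H (2 * k))\<^sup>2"])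
       (simp add: algebra_simps power2_eq_square, unfold x_def, intro int k2)
  have 7: "pcong p 2 (?e * ((1 + of_nat p * (of_nat k * ?H k)) * (1 + of_nat p * (of_nat k * ?H k)))) (1 - 2 * of_nat p * of_nat k * \<Delta>)"
    by (rule sq [where z = "of_nat k * ?H k * (of_nat k * ?H k) * (1 - of_nat p * (of_nat (2 * k) * ?H (2 * k))) - of_nat (2 * k) * ?H (2 * k) * (2 * (of_nat k * ?H k))"])
       (simp add: \<Delta>_def algebra_simps power2_eq_square, intro int k2)
  show ?thesis
    using 5 6 7 pcong_trans [OF p] by blast
qed

end

text \<open>
  Only complete blocks occur, so that all the Gauss factorials are powers of \<open>(p - 1)!\<close>.
\<close>

lemma choose_prime_multiples_cong:
  assumes "prime p" "odd p" "b \<le> a"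
  shows "[(p * a) choose (p * b) = a choose b] (mod p\<^sup>2)"
proof -
  let ?w = "fact (p - 1) :: nat"
  have w: "?w ^ b * ?w ^ (a - b) = ?w ^ a"
    using assms by (simp flip: power_add)
  have "((p * a) choose (p * b)) * (gauss_fact p (p * b) * gauss_fact p (p * (a - b))) = (a choose b) * gauss_fact p (p * a)"
    using choose_gauss_fact [of p 0 0 b a] assms prime_gt_0_nat [of p] by simp
  moreover have "[((p * a) choose (p * b)) * (gauss_fact p (p * b) * gauss_fact p (p * (a - b))) =
      ((p * a) choose (p * b)) * (?w ^ b * ?w ^ (a - b))] (mod p\<^sup>2)"
    by (rule cong_scalar_left [OF cong_mult]) (rule gauss_fact_mult_cong [OF assms(1,2)])+
  moreover have "[(a choose b) * gauss_fact p (p * a) = (a choose b) * ?w ^ a] (mod p\<^sup>2)"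
    by (rule cong_scalar_left [OF gauss_fact_mult_cong [OF assms(1,2)]])
  ultimately have "[((p * a) choose (p * b)) * ?w ^ a = (a choose b) * ?w ^ a] (mod p\<^sup>2)"
    unfolding w using cong_sym cong_trans by metis
  moreover have "coprime (?w ^ a) (p\<^sup>2)"
    using coprime_fact_prime [OF assms(1), of "p - 1"] prime_gt_0_nat [OF assms(1)] by simp
  ultimately show ?thesis
    using cong_mult_rcancel_nat by blast
qed

context
  fixes p k :: nat
  assumes p: "prime p" and pk: "p = 4 * k + 1"
begin

text \<open>
  The term is \<open>p\<close> times \<open>2 B / (4 c + 1)\<close>, where Lucas' theorem gives \<open>B\<close> modulo \<open>p\<close>. With
  \<open>d = k - c\<close> one has \<open>4 c + 1 = p - 4 d\<close>, and the powers of the central binomial coefficient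
  combine to its power with exponent \<open>p - 1\<close>, which is \<open>1\<close> modulo \<open>p\<close>.
\<close>

lemma choose_one_quarter_cong:
  assumes "c < k"
  shows "pcong p 2 (of_nat ((2 * p * quarter p (p - 1)) choose ((4 * c + 1) * quarter p (p - 1))))
    (of_nat p * (1 / 4 * ((-1) ^ (k - c) / of_nat (k - c) * (of_nat ((2 * k) choose c) / of_nat ((2 * k) choose k)))))"
proof -
  let ?K = "quarter p (p - 1)" and ?M = "(2 * k) choose k" and ?d = "k - c" and ?e = "(2 * k) choose c"
  let ?B = "(2 * p * ?K - 1) choose ((4 * c + 1) * ?K - 1)"
  have odd: "odd p" and k0: "k > 0" and d0: "?d > 0" and p4: "p > 4"
    using pk prime_1_mod_4_index_pos [OF p pk] assms by simp_all
  have s: "Suc (Suc (p - 3)) = p - 1" "Suc (p - 2) = p - 1"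
    using p4 by simp_all
  have M: "?M = 2 * ((2 * k - 1) choose k)"
  proof -
    obtain n where n: "k = Suc n"
      using k0 by (cases k) auto
    have "(2 * k - 1) choose n = (2 * k - 1) choose (2 * k - 1 - n)"
      by (rule binomial_symmetric) (simp add: n)
    then show ?thesis
      unfolding n by simp
  qed
  have pM: "\<not> p dvd ?M"
  proof
    assume "p dvd ?M"
    then have "p dvd fact k * fact (2 * k - k) * ?M"
      by (rule dvd_mult)
    then have "p dvd fact (2 * k)"
      using binomial_fact_lemma [of k "2 * k"] by simp
    then show False
      using p pk by (simp add: prime_dvd_fact_iff)
  qed
  have B: "[int ?B = int (?M ^ (p - 3) * ?e * ((2 * k - 1) choose k)) * (-1) ^ (?d - 1)] (mod int p)"
  proof -
    have "[?B = (?M ^ (p - 3) * ?e) * ((2 * k - 1) choose k) * ((p - 1) choose (?d - 1))] (mod p)"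
      using choose_one_quarter_lucas [OF p pk assms, of "p - 3"] unfolding s .
    then have "[int ?B = int ((?M ^ (p - 3) * ?e * ((2 * k - 1) choose k)) * ((p - 1) choose (?d - 1)))] (mod int p)"
      by (simp only: cong_int_iff)
    also have "[int ((?M ^ (p - 3) * ?e * ((2 * k - 1) choose k)) * ((p - 1) choose (?d - 1))) =
        int (?M ^ (p - 3) * ?e * ((2 * k - 1) choose k)) * (-1) ^ (?d - 1)] (mod int p)"
      unfolding of_nat_mult [of "?M ^ (p - 3) * ?e * ((2 * k - 1) choose k)"]
      using pk by (intro cong_scalar_left choose_prime_minus_one_cong p) auto
    finally show ?thesis .
  qed
  \<comment> \<open>the claim modulo \<open>p\<close>, with the denominators \<open>4 c + 1\<close>, \<open>4 d\<close> and \<open>M\<close> cleared\<close>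
  have key: "[8 * int ?d * int ?M * int ?B = (-1) ^ ?d * int ?e * int (4 * c + 1)] (mod int p)"
  proof -
    have k1: "[8 * int ?d * int ?M * int ?B =
        8 * int ?d * int ?M * (int (?M ^ (p - 3) * ?e * ((2 * k - 1) choose k)) * (-1) ^ (?d - 1))] (mod int p)"
      by (rule cong_scalar_left [OF B])
    have e1: "8 * int ?d * int ?M * (int (?M ^ (p - 3) * ?e * ((2 * k - 1) choose k)) * (-1) ^ (?d - 1)) =
        4 * int ?d * (-1) ^ (?d - 1) * int ?e * int ?M ^ (p - 1)"
    proof -
      have "p - 1 = Suc (Suc (p - 3))"
        using s by simp
      then have "int ?M ^ (p - 1) = int ?M * (2 * int ((2 * k - 1) choose k)) * int ?M ^ (p - 3)"
        using M by simp
      then show ?thesis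
        by simp
    qed
    have k2: "[4 * int ?d * (-1) ^ (?d - 1) * int ?e * int ?M ^ (p - 1) = 4 * int ?d * (-1) ^ (?d - 1) * int ?e * 1] (mod int p)"
      by (rule cong_scalar_left [OF fermat_power [OF p pM]])
    have e2: "4 * int ?d * (-1) ^ (?d - 1) * int ?e * 1 = (-1) ^ ?d * int ?e * (int (4 * c + 1) - int p)"
    proof -
      have "(-1) ^ ?d = - ((-1) ^ (?d - 1) :: int)"
        using d0 by (cases ?d) auto
      moreover have "int (4 * c + 1) - int p = - (4 * int ?d)"
        unfolding pk using assms by (simp add: of_nat_diff)
      ultimately show ?thesis
        by simp
    qed
    have k3: "[(-1) ^ ?d * int ?e * (int (4 * c + 1) - int p) = (-1) ^ ?d * int ?e * int (4 * c + 1)] (mod int p)"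
      by (intro cong_scalar_left) (simp add: cong_iff_dvd_diff)
    show ?thesis
      by (rule cong_trans [OF k1], unfold e1, rule cong_trans [OF k2], unfold e2, rule k3)
  qed
  have "\<not> p dvd 4 * c + 1" "\<not> p dvd ?d"
    using assms pk d0 by (auto dest!: dvd_imp_le)
  moreover have "\<not> p dvd 4"
    using p4 by (auto dest: dvd_imp_le)
  ultimately have nd: "\<not> p dvd (4 * c + 1) * (4 * (?d * ?M))"
    using pM unfolding prime_dvd_mult_iff [OF p] by blast
  let ?z = "1 / 4 * ((-1) ^ ?d / of_nat ?d * (of_nat ?e / of_nat ?M)) :: rat"
  have nz: "of_nat (4 * c + 1) \<noteq> (0 :: rat)" "of_nat ?d \<noteq> (0 :: rat)" "of_nat ?M \<noteq> (0 :: rat)"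
    using d0 pM by (auto simp: dvd_def simp flip: of_nat_Suc)
  have "pcong p 1 (of_nat ((4 * c + 1) * (4 * (?d * ?M))) * (2 * of_nat ?B / of_nat (4 * c + 1)))
      (of_nat ((4 * c + 1) * (4 * (?d * ?M))) * ?z)"
  proof -
    have a1: "of_nat ((4 * c + 1) * (4 * (?d * ?M))) * (2 * of_nat ?B / of_nat (4 * c + 1)) =
        (of_int (8 * int ?d * int ?M * int ?B) :: rat)"
      using nz by (simp add: field_simps)
    have a2: "of_nat ((4 * c + 1) * (4 * (?d * ?M))) * ?z = (of_int ((-1) ^ ?d * int ?e * int (4 * c + 1)) :: rat)"
      using nz by (simp add: field_simps)
    show ?thesis
      unfolding a1 a2 pcong_of_int_iff [OF p] power_one_right by (rule key)
  qed
  then have "pcong p 1 (2 * of_nat ?B / of_nat (4 * c + 1)) ?z"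
    by (rule pcong_cancel [OF p nd])
  from pcong_p_mult [OF p this]
  have "pcong p 2 (of_nat p * (2 * of_nat ?B / of_nat (4 * c + 1))) (of_nat p * ?z)"
    unfolding Suc_1 .
  moreover have "of_nat p * (2 * of_nat ?B / of_nat (4 * c + 1)) =
      (of_nat ((2 * p * ?K) choose ((4 * c + 1) * ?K)) :: rat)"
  proof -
    have "(4 * c + 1) * ((2 * p * ?K) choose ((4 * c + 1) * ?K)) = 2 * p * ?B"
      using absorb_multiple_quarter [OF p pk, of "4 * c + 1" "p - 2"] unfolding s by simp
    then have "of_nat ((4 * c + 1) * ((2 * p * ?K) choose ((4 * c + 1) * ?K))) = (of_nat (2 * p * ?B) :: rat)"
      by (simp only:)
    then have "of_nat (4 * c + 1) * of_nat ((2 * p * ?K) choose ((4 * c + 1) * ?K)) = (2 * of_nat p * of_nat ?B :: rat)"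
      unfolding of_nat_mult of_nat_numeral .
    then show ?thesis
      using nz(1) by (simp add: field_simps)
  qed
  ultimately show ?thesis
    by simp
qed

text \<open>
  The symmetry of binomial coefficients exchanges the odd multipliers \<open>l\<close> and \<open>2 p - l\<close>, and the
  middle one is \<open>l = p\<close>. The residue of \<open>l\<close> modulo \<open>4\<close> is preserved because \<open>2 p \<equiv> 2\<close> modulo \<open>4\<close>.
\<close>

lemma sum_choose_odd_quarters_split:
  "(\<Sum>u<p. (2 * p * N) choose ((2 * u + 1) * N)) = ((2 * p * N) choose (p * N)) +
     2 * ((\<Sum>c<k. (2 * p * N) choose ((4 * c + 1) * N)) + (\<Sum>c<k. (2 * p * N) choose ((4 * c + 3) * N)))"
proof -
  let ?f = "\<lambda>u. (2 * p * N) choose ((2 * u + 1) * N)"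
  have *: "{..<p} = {..<2*k} \<union> ({2*k} \<union> {2*k+1..4*k})"
    unfolding pk by auto
  have "(\<Sum>u<p. ?f u) = (\<Sum>u<2*k. ?f u) + (\<Sum>u\<in>{2*k} \<union> {2*k+1..4*k}. ?f u)"
    unfolding * by (rule sum.union_disjoint) auto
  also have "(\<Sum>u\<in>{2*k} \<union> {2*k+1..4*k}. ?f u) = ?f (2*k) + (\<Sum>u=2*k+1..4*k. ?f u)"
    by (subst sum.union_disjoint) auto
  also have "(\<Sum>u=2*k+1..4*k. ?f u) = (\<Sum>u<2*k. ?f (4 * k - u))"
    by (rule sum.reindex_bij_witness [of _ "\<lambda>u. 4*k-u" "\<lambda>u. 4*k-u"]) auto
  also have "\<dots> = (\<Sum>u<2*k. ?f u)"
  proof (intro sum.cong refl)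
    fix u assume "u \<in> {..<2*k}"
    then obtain v where v: "4 * k = u + v" "4 * k - u = v"
      by (metis diff_add_inverse le_add_diff_inverse lessThan_iff less_imp_le mult_2 numeral_Bit0 add_mono_thms_linordered_semiring(1) distrib_right le_add1 order_trans)
    have "2 * p * N = (2 * u + 1) * N + (2 * v + 1) * N"
      unfolding pk v by (simp add: algebra_simps)
    then show "?f (4 * k - u) = ?f u"
      unfolding v(2) by (metis add_diff_cancel_left' binomial_symmetric le_add1)
  qed
  also have "(\<Sum>u<2*n. ?f u) = (\<Sum>c<n. ?f (2 * c)) + (\<Sum>c<n. ?f (2 * c + 1))" for n
    by (induction n) (auto simp: algebra_simps)
  finally show ?thesis
    by (simp add: pk algebra_simps)
qed

text \<open>
  The middle term contributes \<open>1 - 2 (x - 1) + p \<Delta> / 2\<close>, where \<open>x\<close> is the power of the Gauss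
  factorial, and the multipliers congruent to \<open>1\<close> modulo \<open>4\<close> contribute \<open>- p \<Delta> / 2\<close>.
\<close>

lemma sum_choose_odd_quarters_cong:
  "[int (\<Sum>u<p. (2 * p * quarter p (p - 1)) choose ((2 * u + 1) * quarter p (p - 1))) =
    3 - 2 * int (gauss_fact p (p * k + k)) ^ (p - 1)] (mod (int p)\<^sup>2)"
proof -
  let ?K = "quarter p (p - 1)" and ?X = "gauss_fact p (p * k + k)"
  let ?f = "\<lambda>l. (2 * p * ?K) choose (l * ?K)"
  define x where "x = (of_nat ?X ^ (p - 1) :: rat)"
  define \<Delta> where "\<Delta> = ((\<Sum>u=1..2*k. 1 / of_nat u) - (\<Sum>u=1..k. 1 / of_nat u) :: rat)"
  define C where "C = (of_nat ((2 * ?K) choose ?K) :: rat)"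
  have odd: "odd p" and p4: "p > 4"
    using pk prime_1_mod_4_index_pos [OF p pk] by simp_all
  have H: "p_integral p (\<Sum>u=1..r. 1 / of_nat u)" if "r < p" for r
    using that by (intro p_integral_sum p_integral_divide p) (auto simp: p nat_dvd_not_less)
  have \<Delta>: "p_integral p \<Delta>"
    unfolding \<Delta>_def using pk by (intro p_integral_diff p H) auto
  note int = p_integral_add [OF p] p_integral_mult [OF p] p_integral_diff [OF p] p_integral_power [OF p]
    p_integral_of_nat [OF p] p_integral_of_int [OF p] p_integral_numeral [OF p] \<Delta>
  \<comment> \<open>used below with the explicit cofactor \<open>z\<close> of \<open>p\<^sup>2\<close> in a difference of polynomials in \<open>p\<close>\<close>
  have sq: "pcong p 2 a b" if "a - b = of_nat p * of_nat p * z" "p_integral p z" for a b z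
    unfolding pcong_def using that by (intro exI [of _ z]) (simp add: power2_eq_square)
  have central: "pcong p 2 (of_nat (?f p)) C"
  proof -
    have "[?f p = (2 * ?K) choose ?K] (mod p\<^sup>2)"
      using choose_prime_multiples_cong [OF p odd, of ?K "2 * ?K"] by (simp add: mult_ac)
    then show ?thesis
      unfolding C_def using pcong_of_nat_iff [OF p] by blast
  qed
  have one: "pcong p 2 (of_nat (\<Sum>c<k. ?f (4 * c + 1))) (of_nat p * (- \<Delta> / 4))"
  proof -
    let ?g = "\<lambda>d. (-1) ^ d / of_nat d * (of_nat ((2 * k) choose (k - d)) / of_nat ((2 * k) choose k)) :: rat"
    have u1: "pcong p 2 (\<Sum>c<k. of_nat (?f (4 * c + 1))) (\<Sum>c<k. of_nat p * (1 / 4 * ?g (k - c)))"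
      using choose_one_quarter_cong by (intro pcong_sum p) auto
    have u2: "(\<Sum>c<k. of_nat p * (1 / 4 * ?g (k - c))) = of_nat p * (1 / 4 * (\<Sum>c<k. ?g (k - c)))"
      by (simp add: sum_distrib_left)
    have u3: "(\<Sum>c<k. ?g (k - c)) = (\<Sum>d=1..k. ?g d)"
      by (rule sum.reindex_bij_witness [of _ "\<lambda>i. k-i" "\<lambda>i. k-i"]) auto
    have u4: "(\<Sum>d=1..k. ?g d) = - \<Delta>"
      unfolding alternating_choose_harmonic \<Delta>_def by simp
    have u5: "of_nat p * (1 / 4 * - \<Delta>) = of_nat p * (- \<Delta> / 4)"
      by simp
    show ?thesis
      using u1 unfolding u2 u3 u4 u5 of_nat_sum .
  qed
  have three: "pcong p 2 (of_nat (\<Sum>c<k. ?f (4 * c + 3))) 0"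
  proof -
    have s: "Suc (Suc (p - 3)) = p - 1"
      using p4 by simp
    have "p\<^sup>2 dvd ?f (4 * c + 3)" if "c < k" for c
      using choose_three_quarter_dvd [OF p pk, of c "p - 3"] that unfolding s by simp
    then have "[(\<Sum>c<k. ?f (4 * c + 3)) = 0] (mod p\<^sup>2)"
      unfolding cong_0_iff by (intro dvd_sum) auto
    then show ?thesis
      using pcong_of_nat_iff [OF p, of 2 _ 0] by (simp only: of_nat_0)
  qed
  have S: "pcong p 2 (of_nat (\<Sum>u<p. ?f (2 * u + 1))) (C + 2 * (of_nat p * (- \<Delta> / 4) + 0))"
    unfolding sum_choose_odd_quarters_split of_nat_add of_nat_mult of_nat_numeral
    using central one three by (intro pcong_add p pcong_mult_left int) simp_all
  have "[int ?X ^ (p - 1) = 1] (mod int p)"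
  proof (rule fermat_power [OF p])
    show "\<not> p dvd ?X"
      using coprime_gauss_fact [OF p, of "p * k + k"] p coprime_absorb_right not_prime_unit by blast
  qed
  then obtain a where "int ?X ^ (p - 1) - 1 = int p * a"
    unfolding cong_iff_dvd_diff by blast
  then have a: "int ?X ^ (p - 1) = 1 + int p * a"
    by simp
  have xa: "x = 1 + of_nat p * of_int a"
  proof -
    have "x = of_int (int ?X ^ (p - 1))"
      by (simp add: x_def)
    then show ?thesis
      unfolding a by simp
  qed
  have x: "pcong p 2 (C * x\<^sup>2) (1 - 2 * of_nat p * of_nat k * \<Delta>)"
    using choose_central_quarter_harmonic [OF p pk] unfolding C_def x_def \<Delta>_def .
  \<comment> \<open>\<open>1 - 2 p a\<close> is the inverse of \<open>x\<^sup>2 = (1 + p a)\<^sup>2\<close> modulo \<open>p\<^sup>2\<close>\<close>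
  have c1: "pcong p 2 C ((1 - 2 * of_nat p * of_int a) * (C * x\<^sup>2))"
    by (rule sq [where z = "C * (3 * of_int a * of_int a + 2 * of_nat p * of_int a * of_int a * of_int a)"])
       (simp add: xa algebra_simps power2_eq_square, unfold C_def, intro int)
  have c2: "pcong p 2 ((1 - 2 * of_nat p * of_int a) * (C * x\<^sup>2)) ((1 - 2 * of_nat p * of_int a) * (1 - 2 * of_nat p * of_nat k * \<Delta>))"
    by (intro pcong_mult_left p x int)
  have "pcong p 2 C ((1 - 2 * of_nat p * of_int a) * (1 - 2 * of_nat p * of_nat k * \<Delta>))"
    by (rule pcong_trans [OF p c1 c2])
  then have t1: "pcong p 2 (C + 2 * (of_nat p * (- \<Delta> / 4) + 0))
      ((1 - 2 * of_nat p * of_int a) * (1 - 2 * of_nat p * of_nat k * \<Delta>) + 2 * (of_nat p * (- \<Delta> / 4) + 0))"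
    by (intro pcong_add p pcong_refl)
  have t2: "pcong p 2 ((1 - 2 * of_nat p * of_int a) * (1 - 2 * of_nat p * of_nat k * \<Delta>) + 2 * (of_nat p * (- \<Delta> / 4) + 0)) (3 - 2 * of_int (int ?X ^ (p - 1)))"
  \<comment> \<open>as \<open>4 k = p - 1\<close>, the terms \<open>- 2 p k \<Delta>\<close> and \<open>- p \<Delta> / 2\<close> add up to \<open>- p\<^sup>2 \<Delta> / 2\<close>\<close>
  proof (rule sq [where z = "4 * of_int a * of_nat k * \<Delta> - \<Delta> / of_nat 2"])
    show "(1 - 2 * of_nat p * of_int a) * (1 - 2 * of_nat p * of_nat k * \<Delta>) + 2 * (of_nat p * (- \<Delta> / 4) + 0) -
        (3 - 2 * of_int (int ?X ^ (p - 1))) = of_nat p * of_nat p * (4 * of_int a * of_nat k * \<Delta> - \<Delta> / of_nat 2)"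
    proof -
      have k: "of_nat k = (of_nat p - 1) / (4 :: rat)"
        by (simp add: pk)
      show ?thesis
        unfolding a k by (simp add: field_simps)
    qed
    show "p_integral p (4 * of_int a * of_nat k * \<Delta> - \<Delta> / of_nat 2)"
      using p4 by (intro int p_integral_divide p) (auto dest: dvd_imp_le)
  qed
  from pcong_trans [OF p S pcong_trans [OF p t1 t2]]
  have "pcong p 2 (of_int (int (\<Sum>u<p. ?f (2 * u + 1)))) (of_int (3 - 2 * int ?X ^ (p - 1)))"
    by (simp only: of_int_of_nat_eq of_int_diff of_int_mult of_int_numeral)
  then show ?thesis
    by (simp only: pcong_of_int_iff [OF p])
qed

end

section \<open>Integer polynomials modulo an ideal and their values in a field\<close>

text \<open>
  Congruence modulo the ideal \<open>(N, f)\<close> of \<open>\<int>[X]\<close>. For \<open>N = p\<^sup>2\<close> and a suitable \<open>f\<close> the quotient is a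
  Galois ring; stating it as a congruence avoids a quotient type that would depend on the field.
\<close>

definition poly_cong :: "int \<Rightarrow> int poly \<Rightarrow> int poly \<Rightarrow> int poly \<Rightarrow> bool" where
  "poly_cong N f P Q \<longleftrightarrow> (\<exists>u v. P - Q = smult N u + f * v)"

lemma poly_congI: "P - Q = smult N u + f * v \<Longrightarrow> poly_cong N f P Q"
  unfolding poly_cong_def by blast

lemma poly_cong_refl [simp, intro]: "poly_cong N f P P"
  by (rule poly_congI [of _ _ _ 0 _ 0]) simp

lemma poly_cong_sym: assumes "poly_cong N f P Q" shows "poly_cong N f Q P"
proof -
  obtain u v where "P - Q = smult N u + f * v"
    using assms unfolding poly_cong_def by blast
  then have "Q - P = smult N (- u) + f * (- v)"
    by (simp add: algebra_simps)
  then show ?thesis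
    by (rule poly_congI)
qed

lemma poly_cong_add: assumes "poly_cong N f P Q" "poly_cong N f P' Q'" shows "poly_cong N f (P + P') (Q + Q')"
proof -
  obtain u v u' v' where "P - Q = smult N u + f * v" "P' - Q' = smult N u' + f * v'"
    using assms unfolding poly_cong_def by blast
  then have "P + P' - (Q + Q') = smult N (u + u') + f * (v + v')"
    by (simp add: algebra_simps smult_add_right)
  then show ?thesis
    by (rule poly_congI)
qed

lemma poly_cong_trans [trans]: assumes "poly_cong N f P Q" "poly_cong N f Q R" shows "poly_cong N f P R"
  using poly_cong_add [OF assms] unfolding poly_cong_def by simp

lemma poly_cong_mult_left: assumes "poly_cong N f P Q" shows "poly_cong N f (R * P) (R * Q)"
proof -
  obtain u v where "P - Q = smult N u + f * v"
    using assms unfolding poly_cong_def by blast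
  then have "R * P - R * Q = R * (smult N u + f * v)"
    by (metis right_diff_distrib)
  also have "\<dots> = smult N (R * u) + f * (R * v)"
    by (simp add: algebra_simps)
  finally show ?thesis
    by (rule poly_congI)
qed

lemma poly_cong_mult: assumes "poly_cong N f P Q" "poly_cong N f P' Q'" shows "poly_cong N f (P * P') (Q * Q')"
proof -
  have "poly_cong N f (P * Q') (Q * Q')"
    using poly_cong_mult_left [OF assms(1), of Q'] by (simp add: mult.commute)
  with poly_cong_mult_left [OF assms(2), of P] show ?thesis
    by (rule poly_cong_trans)
qed

lemma poly_cong_power: "poly_cong N f P Q \<Longrightarrow> poly_cong N f (P ^ n) (Q ^ n)"
  by (induction n) (auto intro: poly_cong_mult)

lemma poly_cong_sum: "(\<And>i. i \<in> S \<Longrightarrow> poly_cong N f (g i) (h i)) \<Longrightarrow> poly_cong N f (sum g S) (sum h S)"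
  by (induction S rule: infinite_finite_induct) (auto intro: poly_cong_add)

lemma monic_int_poly_division:
  fixes f P :: "int poly"
  assumes "lead_coeff f = 1"
  obtains s r where "P = f * s + r" "r = 0 \<or> degree r < degree f"
proof -
  obtain s r where "pseudo_divmod P f = (s, r)"
    by force
  moreover have "f \<noteq> 0"
    using assms by auto
  ultimately show ?thesis
    using pseudo_divmod [of f P s r] that assms by auto
qed

text \<open>
  This is what brings a congruence between integers back from the quotient ring. Division by \<open>f\<close>
  reduces the coefficient of \<open>N\<close> to degree less than that of \<open>f\<close>; then the multiple of \<open>f\<close> must
  vanish.
\<close>

lemma poly_cong_const_imp_dvd:
  assumes "lead_coeff f = 1" "degree f > 0" "poly_cong N f [:m:] 0"
  shows "N dvd m"
proof -
  obtain u v where uv: "[:m:] = smult N u + f * v"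
    using assms(3) unfolding poly_cong_def by auto
  obtain s r where r: "u = f * s + r" "r = 0 \<or> degree r < degree f"
    by (rule monic_int_poly_division [OF assms(1)])
  have eq: "f * (v + smult N s) = [:m:] - smult N r"
    using uv r(1) by (simp add: algebra_simps smult_add_right)
  have "v + smult N s = 0"
  proof (rule ccontr)
    assume nz: "v + smult N s \<noteq> 0"
    have "f \<noteq> 0"
      using assms by auto
    then have "degree f \<le> degree ([:m:] - smult N r)"
      unfolding eq [symmetric] using nz by (simp add: degree_mult_eq)
    also have "degree ([:m:] - smult N r) < degree f"
    proof (rule degree_diff_less)
      show "degree [:m:] < degree f"
        using assms by simp
      show "degree (smult N r) < degree f"
        using r(2) assms by (cases "N = 0") auto
    qed
    finally show False
      by simp
  qed
  then have "[:m:] = smult N r"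
    using eq by simp
  then have "coeff [:m:] 0 = N * coeff r 0"
    by (metis coeff_smult)
  then show ?thesis
    by simp
qed

lemma power_add_smult:
  fixes Q u :: "int poly"
  shows "\<exists>w. (Q + smult N u) ^ Suc n = Q ^ Suc n + smult (int (Suc n) * N) (u * Q ^ n) + smult (N\<^sup>2) w"
proof (induction n)
  case 0
  show ?case
    by (rule exI [of _ 0]) simp
next
  case (Suc n)
  then obtain w where w: "(Q + smult N u) ^ Suc n = Q ^ Suc n + smult (int (Suc n) * N) (u * Q ^ n) + smult (N\<^sup>2) w"
    by blast
  have "(Q + smult N u) ^ Suc (Suc n) = (Q + smult N u) * (Q ^ Suc n + smult (int (Suc n) * N) (u * Q ^ n) + smult (N\<^sup>2) w)"
    by (simp only: power_Suc [of "Q + smult N u" "Suc n"] w)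
  also have "\<dots> = Q ^ Suc (Suc n) + smult (int (Suc (Suc n)) * N) (u * Q ^ Suc n) +
      smult (N\<^sup>2) (smult (int (Suc n)) (u * u * Q ^ n) + (Q + smult N u) * w)"
    by (simp add: algebra_simps smult_add_right smult_add_left power2_eq_square) (simp add: numeral_poly)
  finally show ?case
    by blast
qed

text \<open>
  Raising to the power \<open>p\<close> improves a congruence modulo \<open>p\<close> to one modulo \<open>p\<^sup>2\<close>, as for integers.
\<close>

lemma poly_cong_power_prime:
  assumes "poly_cong (int p) f P Q" "p > 0"
  shows "poly_cong ((int p)\<^sup>2) f (P ^ p) (Q ^ p)"
proof -
  obtain u v where uv: "P - Q = smult (int p) u + f * v"
    using assms(1) unfolding poly_cong_def by blast
  define R where "R = Q + smult (int p) u"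
  have "P - R = f * v"
    using uv unfolding R_def by (simp add: algebra_simps)
  moreover have "P - R dvd P ^ p - R ^ p"
    by (simp add: power_diff_sumr2)
  ultimately obtain v' where v': "P ^ p - R ^ p = f * v'"
    by (metis dvd_def dvd_mult_left)
  obtain n where n: "p = Suc n"
    using assms(2) by (cases p) auto
  obtain w where "R ^ p = Q ^ p + smult (int p * int p) (u * Q ^ n) + smult ((int p)\<^sup>2) w"
    using power_add_smult [of Q "int p" u n] unfolding R_def n by blast
  then have "P ^ p - Q ^ p = smult ((int p)\<^sup>2) (u * Q ^ n + w) + f * v'"
    using v' by (simp add: algebra_simps smult_add_right power2_eq_square)
  then show ?thesis
    by (rule poly_congI)
qed

definition eval_poly :: "('a, 'r) ring_scheme \<Rightarrow> 'a \<Rightarrow> int poly \<Rightarrow> 'a" where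
  "eval_poly F g P = fold_coeffs (\<lambda>a x. ([a] \<cdot>\<^bsub>F\<^esub> \<one>\<^bsub>F\<^esub>) \<oplus>\<^bsub>F\<^esub> (g \<otimes>\<^bsub>F\<^esub> x)) P \<zero>\<^bsub>F\<^esub>"

context cring
begin

lemma int_embed_closed [simp]: "[(a::int)] \<cdot> \<one> \<in> carrier R"
  by simp

lemma int_embed_0 [simp]: "[(0::int)] \<cdot> \<one> = \<zero>"
  by (simp add: add_pow_int_ge)

lemma int_embed_1 [simp]: "[(1::int)] \<cdot> \<one> = \<one>"
  using add.int_pow_1 [of \<one>] by simp

lemma int_embed_add: "[(a + b::int)] \<cdot> \<one> = [a] \<cdot> \<one> \<oplus> [b] \<cdot> \<one>"
  by (simp add: add.int_pow_mult)

lemma int_embed_mult: "[(a * b::int)] \<cdot> \<one> = ([a] \<cdot> \<one>) \<otimes> ([b] \<cdot> \<one>)"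
  by (simp add: add_pow_ldistr_int add.int_pow_pow mult.commute)

lemma int_embed_uminus: "[(- a::int)] \<cdot> \<one> = \<ominus> ([a] \<cdot> \<one>)"
  by (simp add: add.int_pow_neg)

lemma eval_poly_0 [simp]: "eval_poly R g 0 = \<zero>"
  by (simp add: eval_poly_def)

context
  fixes g
  assumes g: "g \<in> carrier R"
begin

lemma eval_poly_pCons: "eval_poly R g (pCons a P) = ([a] \<cdot> \<one>) \<oplus> (g \<otimes> eval_poly R g P)"
proof (cases "a = 0 \<and> P = 0")
  case True
  then show ?thesis
    using g by simp
next
  case False
  then show ?thesis
    by (cases "a = 0") (auto simp: eval_poly_def)
qed

lemma eval_poly_closed [simp]: "eval_poly R g P \<in> carrier R"
  by (induction P) (use g in \<open>simp_all add: eval_poly_pCons\<close>)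

lemma eval_poly_add: "eval_poly R g (P + Q) = eval_poly R g P \<oplus> eval_poly R g Q"
proof (induction P Q rule: poly_induct2)
  case (pCons a P b Q)
  have "eval_poly R g (pCons a P + pCons b Q) =
      ([a] \<cdot> \<one> \<oplus> [b] \<cdot> \<one>) \<oplus> g \<otimes> (eval_poly R g P \<oplus> eval_poly R g Q)"
    by (simp add: eval_poly_pCons int_embed_add pCons)
  also have "\<dots> = eval_poly R g (pCons a P) \<oplus> eval_poly R g (pCons b Q)"
    using g by (simp add: eval_poly_pCons r_distr a_ac)
  finally show ?case .
qed simp

lemma eval_poly_smult: "eval_poly R g (smult a P) = ([a] \<cdot> \<one>) \<otimes> eval_poly R g P"
proof (induction P)
  case (pCons b P)
  show ?case
    using g by (simp add: eval_poly_pCons int_embed_mult pCons r_distr m_lcomm)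
qed simp

lemma eval_poly_mult: "eval_poly R g (P * Q) = eval_poly R g P \<otimes> eval_poly R g Q"
proof (induction P)
  case (pCons a P)
  have "eval_poly R g (pCons a P * Q) = ([a] \<cdot> \<one>) \<otimes> eval_poly R g Q \<oplus> g \<otimes> (eval_poly R g P \<otimes> eval_poly R g Q)"
    using g by (simp add: eval_poly_add eval_poly_smult eval_poly_pCons pCons)
  also have "\<dots> = eval_poly R g (pCons a P) \<otimes> eval_poly R g Q"
    using g by (simp add: eval_poly_pCons l_distr m_assoc)
  finally show ?case .
qed simp

lemma eval_poly_const: "eval_poly R g [:a:] = [a] \<cdot> \<one>"
  using g by (simp add: eval_poly_pCons)

lemma eval_poly_1 [simp]: "eval_poly R g 1 = \<one>"
  unfolding one_pCons eval_poly_const by simp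

lemma eval_poly_power: "eval_poly R g (P ^ n) = eval_poly R g P [^] n"
  by (induction n) (simp_all add: eval_poly_mult m_comm)

lemma eval_poly_X: "eval_poly R g [:0, 1:] = g"
  using g by (simp add: eval_poly_pCons)

lemma eval_poly_uminus: "eval_poly R g (- P) = \<ominus> eval_poly R g P"
  using eval_poly_smult [of "-1" P] by (simp add: int_embed_uminus l_minus)

lemma eval_poly_diff: "eval_poly R g (P - Q) = eval_poly R g P \<ominus> eval_poly R g Q"
  using eval_poly_add [of P "- Q"] by (simp add: eval_poly_uminus minus_eq)

end
end

text \<open>
  If the leading coefficient is not divisible by \<open>p\<close>, a multiple of the polynomial can be made monic
  by changing it by a multiple of \<open>p\<close>, against the minimality of \<open>d\<close>. Otherwise the leading term can
  be dropped.
\<close>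

lemma (in cring) eval_poly_kernel_dvd:
  fixes p :: nat
  assumes g: "g \<in> carrier R" and p: "prime p" and char: "[int p] \<cdot> \<one> = \<zero>"
    and min: "\<And>h. lead_coeff h = 1 \<Longrightarrow> eval_poly R g h = \<zero> \<Longrightarrow> d \<le> degree h"
    and "eval_poly R g r = \<zero>" "r = 0 \<or> degree r < d"
  shows "\<exists>u. r = smult (int p) u"
  using assms(5,6)
proof (induction "degree r" arbitrary: r rule: less_induct)
  case less
  have multiple: "[(int p * a)] \<cdot> \<one> = \<zero>" for a
    using char by (simp add: int_embed_mult)
  show ?case
  proof (cases "r = 0")
    case True
    then show ?thesis
      by (intro exI [of _ 0]) simp
  next
    case False
    let ?n = "degree r" and ?c = "lead_coeff r"
    show ?thesis
    proof (cases "int p dvd ?c")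
      case True
      then obtain a where a: "?c = int p * a"
        by blast
      define r' where "r' = r - monom ?c ?n"
      have r: "r = r' + smult (int p) (monom a ?n)"
        unfolding r'_def a by (simp add: smult_monom)
      have "eval_poly R g (smult (int p) (monom a ?n)) = \<zero>"
        using char by (simp add: eval_poly_smult g)
      then have ev: "eval_poly R g r' = \<zero>"
        using less.prems(1) r eval_poly_add [OF g, of r' "smult (int p) (monom a ?n)"] by (simp add: g)
      have "r' = 0 \<or> degree r' < degree r"
      proof (cases "?n = 0")
        case True
        then have "r' = 0"
          unfolding r'_def by (metis degree_0_id diff_self monom_0)
        then show ?thesis ..
      next
        case False
        have "degree r' < degree r"
        proof (rule le_less_trans)
          show "degree r' \<le> ?n - 1"
          proof (rule degree_le, intro allI impI)
            fix i assume "?n - 1 < i"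
            then have "i = ?n \<or> i > ?n"
              by linarith
            then show "coeff r' i = 0"
              unfolding r'_def by (auto simp: coeff_eq_0)
          qed
        qed (use False in simp)
        then show ?thesis ..
      qed
      then obtain u where "r' = smult (int p) u"
        using less.hyps [of r'] ev less.prems(2) False by (metis less_trans smult_0_right)
      then have "r = smult (int p) (u + monom a ?n)"
        using r by (simp add: smult_add_right)
      then show ?thesis
        by blast
    next
      case ndvd: False
      have "coprime ?c (int p)"
        using ndvd p by (simp add: prime_imp_coprime coprime_commute)
      then obtain b where "[?c * b = 1] (mod int p)"
        using cong_solve_coprime_int by blast
      then obtain a where a: "?c * b = 1 + int p * a"
        by (metis cong_iff_lin cong_sym)
      \<comment> \<open>\<open>b\<close> inverts the leading coefficient modulo \<open>p\<close>; subtracting the excess makes it equal to 1\<close>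
      define h where "h = smult b r - monom (int p * a) ?n"
      have "coeff h ?n = 1"
        unfolding h_def using a by (simp add: mult.commute)
      moreover have "degree h \<le> ?n"
        unfolding h_def by (intro degree_diff_le degree_smult_le degree_monom_le)
      ultimately have deg: "degree h = ?n" "lead_coeff h = 1"
        by (metis le_antisym le_degree zero_neq_one)+
      have "monom (int p * a) ?n = smult (int p) (monom a ?n)"
        by (simp add: smult_monom)
      then have "eval_poly R g h = \<zero>"
        unfolding h_def using less.prems(1) char by (simp add: eval_poly_diff eval_poly_smult g)
      then show ?thesis
        using min [of h] deg less.prems(2) False by auto
    qed
  qed
qed

text \<open>
  The polynomial \<open>f\<close> is a monic integer lift of the minimal polynomial of \<open>g\<close> over the prime field.
  It exists because \<open>X ^ n - 1\<close> is one monic integer polynomial with root \<open>g\<close>.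
\<close>

lemma (in field) eval_poly_kernel:
  fixes p :: nat
  assumes g: "g \<in> carrier R" and p: "prime p" and char: "[int p] \<cdot> \<one> = \<zero>"
    and order: "g [^] n = \<one>" "n > (0::nat)"
  obtains f where "lead_coeff f = 1" "degree f > 0"
    "\<And>P. eval_poly R g P = \<zero> \<Longrightarrow> poly_cong (int p) f P 0"
proof -
  let ?Q = "\<lambda>h. lead_coeff h = 1 \<and> eval_poly R g h = \<zero>"
  let ?h = "[:0, 1:] ^ n - 1 :: int poly"
  have "lead_coeff ?h = 1"
  proof -
    have "[:0, 1:] ^ n = monom (1 :: int) n"
      by (simp add: monom_altdef)
    then have "degree ([:0, 1:] ^ n :: int poly) = n" "coeff ([:0, 1:] ^ n :: int poly) n = 1"
      by (simp_all add: degree_monom_eq)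
    moreover from this have "degree ?h = n"
      using order(2) degree_add_eq_left [of "-1" "[:0, 1:] ^ n :: int poly"] by simp
    ultimately show ?thesis
      using order(2) by simp
  qed
  moreover have "eval_poly R g ?h = \<zero>"
    using order g by (simp add: eval_poly_diff eval_poly_power eval_poly_X)
  ultimately have ex: "?Q ?h" ..
  define f where "f = (ARG_MIN degree h. ?Q h)"
  have f: "?Q f" and min: "\<And>h. ?Q h \<Longrightarrow> degree f \<le> degree h"
    using arg_min_natI [of ?Q ?h degree] arg_min_nat_le [of ?Q _ degree] ex unfolding f_def by auto
  have "degree f > 0"
  proof (rule ccontr)
    assume "\<not> degree f > 0"
    then have "f = 1"
      using f by (metis degree_0_id not_gr_zero one_pCons coeff_pCons_0)
    then show False
      using f g by simp
  qed
  moreover have "poly_cong (int p) f P 0" if P: "eval_poly R g P = \<zero>" for P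
  proof -
    obtain s r where r: "P = f * s + r" "r = 0 \<or> degree r < degree f"
      using monic_int_poly_division f by blast
    have "eval_poly R g r = \<zero>"
      using P f g unfolding r(1) by (simp add: eval_poly_add eval_poly_mult)
    then obtain u where "r = smult (int p) u"
      using eval_poly_kernel_dvd [OF g p char, of "degree f" r] min r(2) by blast
    then show ?thesis
      unfolding r(1) by (intro poly_congI [of _ _ _ u _ s]) simp
  qed
  ultimately show ?thesis
    using that f by blast
qed

section \<open>Counting points with Teichmueller lifts\<close>

lemma poly_cong_unit_cancel:
  assumes "poly_cong N f (U * V) 1" "poly_cong N f (U * S) 0"
  shows "poly_cong N f S 0"
proof -
  have "poly_cong N f (V * (U * S)) (V * 0)"
    by (rule poly_cong_mult_left [OF assms(2)])
  moreover have "poly_cong N f (S * (U * V)) (S * 1)"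
    by (rule poly_cong_mult_left [OF assms(1)])
  moreover have "V * (U * S) = S * (U * V)"
    by (simp only: mult_ac)
  ultimately show ?thesis
    by (metis mult_1_right mult_zero_right poly_cong_sym poly_cong_trans)
qed

text \<open>
  Every element of the field is the value of an integer polynomial at the generator \<open>g\<close> of the
  multiplicative group; the elements are lifted through this presentation.
\<close>

locale cyclic_field = field F for F (structure) +
  fixes p q :: nat and g
  assumes prime_p: "prime p" and odd_p: "odd p"
    and card_F: "card (carrier F) = q"
    and p_dvd_q: "p dvd q"
    and char_p: "[int p] \<cdot> \<one> = \<zero>"
    and g_closed [simp]: "g \<in> carrier F"
    and g_nonzero: "g \<noteq> \<zero>"
    and g_power_eq_1_iff: "g [^] (n::nat) = \<one> \<longleftrightarrow> q - 1 dvd n"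
    and nonzero_eq_powers: "carrier F - {\<zero>} = (\<lambda>j. g [^] j) ` {..<q-1}"
    and inj_powers: "inj_on (\<lambda>j::nat. g [^] j) {..<q-1}"
    and odd_q: "odd q" and q_gt_1: "q > 1"
begin

abbreviation ev where "ev \<equiv> eval_poly F g"

abbreviation X :: "int poly" where "X \<equiv> [:0, 1:]"

lemma finite_F: "finite (carrier F)"
  using card_F q_gt_1 card.infinite by fastforce

lemma ev_X_power: "ev (X ^ n) = g [^] n"
  by (simp add: eval_poly_power eval_poly_X)

text \<open>
  Identities in the field are lifted to the ring \<open>\<int>[X] / (p\<^sup>2, f)\<close> through this property of \<open>p\<close>-th
  powers. It holds because polynomials with equal values at \<open>g\<close> are congruent modulo \<open>p\<close> and \<open>f\<close>.
\<close>

lemma exists_modulus: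
  obtains f where "lead_coeff f = 1" "degree f > 0"
    "\<And>P Q. ev P = ev Q \<Longrightarrow> poly_cong ((int p)\<^sup>2) f (P ^ p) (Q ^ p)"
proof -
  have "g [^] (q - 1) = \<one>" "q - 1 > 0"
    using g_power_eq_1_iff [of "q - 1"] q_gt_1 by auto
  from eval_poly_kernel [OF g_closed prime_p char_p this]
  obtain f where f: "lead_coeff f = 1" "degree f > 0" "\<And>P. ev P = \<zero> \<Longrightarrow> poly_cong (int p) f P 0"
    by metis
  have "poly_cong ((int p)\<^sup>2) f (P ^ p) (Q ^ p)" if "ev P = ev Q" for P Q
  proof (rule poly_cong_power_prime)
    have "poly_cong (int p) f (P - Q) 0"
      using f(3) that by (simp add: eval_poly_diff)
    then show "poly_cong (int p) f P Q"
      unfolding poly_cong_def by simp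
  qed (use prime_p prime_gt_0_nat in blast)
  with f that show ?thesis
    by blast
qed

context
  fixes f
  assumes f_monic: "lead_coeff f = 1" and f_degree: "degree f > 0"
    and lift: "\<And>P Q. ev P = ev Q \<Longrightarrow> poly_cong ((int p)\<^sup>2) f (P ^ p) (Q ^ p)"
begin

abbreviation pc where "pc \<equiv> poly_cong ((int p)\<^sup>2) f"

text \<open>
  The Teichmueller lift of the generator \<open>g\<close>. The exponent \<open>q\<close> does not change the value at \<open>g\<close>, and
  being a multiple of \<open>p\<close> it makes the lift a root of unity of order dividing \<open>q - 1\<close>.
\<close>

definition teich :: "int poly" where "teich = X ^ q"

lemma g_power_q: "g [^] q = g"
proof -
  have "g [^] q = g [^] (q - 1) \<otimes> g"
    using q_gt_1 nat_pow_Suc [of g "q - 1"] by simp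
  then show ?thesis
    using g_power_eq_1_iff [of "q - 1"] by simp
qed

lemma ev_teich_power: "ev (teich ^ n) = g [^] n"
  by (simp add: eval_poly_power teich_def ev_X_power g_power_q)

lemma teich_order: "pc (teich ^ (q - 1)) 1"
proof -
  obtain e where e: "q = p * e"
    using p_dvd_q by blast
  have "ev (X ^ (q - 1)) = ev 1"
    using g_power_eq_1_iff [of "q - 1"] by (simp add: ev_X_power)
  then have "pc ((X ^ (q - 1)) ^ p) (1 ^ p)"
    by (rule lift)
  then have "pc (((X ^ (q - 1)) ^ p) ^ e) ((1 ^ p) ^ e)"
    by (rule poly_cong_power)
  moreover have "((X ^ (q - 1)) ^ p) ^ e = teich ^ (q - 1)"
    unfolding teich_def power_mult [symmetric] e [symmetric] by (simp only: mult.assoc mult.commute e)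
  ultimately show ?thesis
    by simp
qed

lemma teich_power_cong_1: assumes "q - 1 dvd n" shows "pc (teich ^ n) 1"
proof -
  obtain e where "n = (q - 1) * e"
    using assms by blast
  then show ?thesis
    using poly_cong_power [OF teich_order, of e] by (simp add: power_mult)
qed

text \<open>
  The inverse of the value is a power of \<open>g\<close>, so that some product \<open>P * X ^ i\<close> has the value \<open>1\<close>, and
  its \<open>p\<close>-th power is congruent to \<open>1\<close>.
\<close>

lemma nonzero_unit:
  assumes "ev P \<noteq> \<zero>"
  obtains V where "pc (P * V) 1"
proof -
  have "ev P \<in> carrier F - {\<zero>}"
    using assms by simp
  then obtain j where j: "ev P = g [^] j" "j < q - 1"
    unfolding nonzero_eq_powers by blast
  have "ev (P * X ^ (q - 1 - j)) = g [^] j \<otimes> g [^] (q - 1 - j)"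
    by (simp add: eval_poly_mult ev_X_power j(1))
  also have "\<dots> = g [^] (q - 1)"
    using j(2) by (simp add: nat_pow_mult)
  also have "\<dots> = ev 1"
    using g_power_eq_1_iff [of "q - 1"] by simp
  finally have "pc ((P * X ^ (q - 1 - j)) ^ p) (1 ^ p)"
    by (rule lift)
  moreover have "(P * X ^ (q - 1 - j)) ^ p = P * (P ^ (p - 1) * (X ^ (q - 1 - j)) ^ p)"
    using prime_gt_0_nat [OF prime_p] by (cases p) (simp_all add: power_mult_distrib mult_ac)
  ultimately show ?thesis
    using that by simp
qed

text \<open>
  Orthogonality of characters. In the second case the geometric sum is annihilated by
  \<open>teich ^ n - 1\<close>, which is a unit and not merely nonzero.
\<close>

lemma sum_teich_powers:
  "pc (\<Sum>j<q-1. teich ^ (j * n)) (if q - 1 dvd n then [:int (q - 1):] else 0)"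
proof (cases "q - 1 dvd n")
  case True
  have "pc (\<Sum>j<q-1. teich ^ (j * n)) (\<Sum>j<q-1. 1)"
    using True by (intro poly_cong_sum teich_power_cong_1) simp
  then show ?thesis
    using True by (simp add: of_nat_poly)
next
  case False
  have "g [^] n \<noteq> \<one>"
    using False g_power_eq_1_iff by simp
  then have "ev (teich ^ n - 1) \<noteq> \<zero>"
    by (simp add: eval_poly_diff ev_teich_power)
  then obtain V where V: "pc ((teich ^ n - 1) * V) 1"
    by (rule nonzero_unit)
  have "(\<Sum>j<q-1. teich ^ (j * n)) = (\<Sum>j<q-1. (teich ^ n) ^ j)"
    by (intro sum.cong refl) (metis mult.commute power_mult)
  then have "(teich ^ n - 1) * (\<Sum>j<q-1. teich ^ (j * n)) = (teich ^ n) ^ (q - 1) - 1"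
    by (simp only: power_diff_1_eq)
  also have "(teich ^ n) ^ (q - 1) = teich ^ ((q - 1) * n)"
    by (metis mult.commute power_mult)
  finally have "(teich ^ n - 1) * (\<Sum>j<q-1. teich ^ (j * n)) = teich ^ ((q - 1) * n) - 1" .
  moreover have "pc (teich ^ ((q - 1) * n) - 1) 0"
    using teich_power_cong_1 [of "(q - 1) * n"] unfolding poly_cong_def by simp
  ultimately have "pc (\<Sum>j<q-1. teich ^ (j * n)) 0"
    using poly_cong_unit_cancel [OF V] by simp
  then show ?thesis
    using False by simp
qed

end

lemma minus_one_neq_one: "\<ominus> \<one> \<noteq> \<one>"
proof
  assume "\<ominus> \<one> = \<one>"
  then have two: "[(2::int)] \<cdot> \<one> = \<zero>"
    using int_embed_add [of 1 1] by (metis int_embed_1 one_closed one_add_one r_neg)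
  obtain h where "p = 2 * h + 1"
    using odd_p oddE by blast
  then have "[int p] \<cdot> \<one> = [(2::int)] \<cdot> \<one> \<otimes> [int h] \<cdot> \<one> \<oplus> \<one>"
    by (simp add: int_embed_add int_embed_mult a_comm)
  then show False
    using char_p two by simp
qed

text \<open>
  The number \<open>c\<close> is the value of the quadratic character at \<open>u\<close>, and the first statement is Euler's
  criterion. Since \<open>c\<close> is \<open>0\<close>, \<open>1\<close> or \<open>-1\<close>, taking \<open>p\<close>-th powers does not change it.
\<close>

lemma card_square_roots:
  assumes u: "u \<in> carrier F"
  defines "c \<equiv> int (card {y \<in> carrier F. y [^] (2::nat) = u}) - 1"
  shows "[c] \<cdot> \<one> = u [^] ((q - 1) div 2)" "c ^ p = c"
proof -
  let ?h = "(q - 1) div 2"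
  have h: "?h > 0" "q - 1 = 2 * ?h"
    using q_gt_1 odd_q by (auto elim!: oddE)
  have sq: "y [^] (2::nat) = y \<otimes> y" if "y \<in> carrier F" for y
    using that by (simp add: numeral_2_eq_2)
  have "[c] \<cdot> \<one> = u [^] ?h \<and> c ^ p = c"
  proof (cases "u = \<zero>")
    case True
    have "{y \<in> carrier F. y [^] (2::nat) = u} = {\<zero>}"
      using True by (auto simp: sq integral_iff)
    then have "c = 0"
      unfolding c_def by simp
    then show ?thesis
      using True h prime_gt_0_nat [OF prime_p] by (simp add: nat_pow_zero zero_power)
  next
    case False
    then have "u \<in> carrier F - {\<zero>}"
      using u by simp
    then obtain j :: nat where j: "u = g [^] j"
      unfolding nonzero_eq_powers by blast
    show ?thesis
    proof (cases "\<exists>y \<in> carrier F. y [^] (2::nat) = u")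
      case True
      then obtain y where y: "y \<in> carrier F" "y [^] (2::nat) = u"
        by blast
      have ynz: "y \<noteq> \<zero>"
        using y False by (auto simp: sq)
      have "\<ominus> y \<noteq> y"
      proof
        assume "\<ominus> y = y"
        then have "y \<otimes> (\<ominus> \<one>) = y \<otimes> \<one>"
          using y(1) by (simp add: r_minus)
        then show False
          using minus_one_neq_one ynz y(1) by (metis m_lcancel a_inv_closed one_closed)
      qed
      moreover have "{z \<in> carrier F. z [^] (2::nat) = u} = {y, \<ominus> y}"
      proof (intro equalityI subsetI)
        fix z assume "z \<in> {z \<in> carrier F. z [^] (2::nat) = u}"
        then have z: "z \<in> carrier F" "z \<otimes> z = y \<otimes> y"
          using y by (auto simp: sq)
        have "(z \<ominus> y) \<otimes> (z \<oplus> y) = z \<otimes> z \<ominus> y \<otimes> y"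
          using z y by algebra
        also have "\<dots> = \<zero>"
          using z y by simp
        finally have "z \<ominus> y = \<zero> \<or> z \<oplus> y = \<zero>"
          using z y by (simp add: integral_iff)
        then show "z \<in> {y, \<ominus> y}"
          using z y by (auto simp: minus_equality r_right_minus_eq)
      qed (use y in \<open>auto simp: sq l_minus r_minus\<close>)
      ultimately have "c = 1"
        unfolding c_def by auto
      moreover have "u [^] ?h = \<one>"
      proof -
        have "u [^] ?h = y [^] (q - 1)"
          using y h(2) by (metis nat_pow_pow)
        moreover obtain i :: nat where "y = g [^] i"
          using ynz y(1) nonzero_eq_powers by blast
        ultimately show ?thesis
          using g_power_eq_1_iff [of "i * (q - 1)"] by (simp add: nat_pow_pow)
      qed
      ultimately show ?thesis
        by simp
    next
      case no: False
      then have "{y \<in> carrier F. y [^] (2::nat) = u} = {}"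
        by blast
      then have c: "c = - 1"
        unfolding c_def by (simp only: card.empty)
      have "odd j"
      proof
        assume "even j"
        then obtain i where "j = i * 2"
          by (metis dvd_def mult.commute)
        then have "(g [^] i) [^] (2::nat) = u"
          unfolding j by (simp add: nat_pow_pow)
        then show False
          using no by auto
      qed
      have "u [^] ?h \<noteq> \<one>"
      proof
        assume "u [^] ?h = \<one>"
        then have "2 * ?h dvd j * ?h"
          using g_power_eq_1_iff [of "j * ?h"] h(2) unfolding j by (simp add: nat_pow_pow)
        then show False
          using h(1) \<open>odd j\<close> by simp
      qed
      moreover have "u [^] ?h \<otimes> u [^] ?h = \<one>"
      proof -
        have "u [^] ?h \<otimes> u [^] ?h = u [^] (q - 1)"
          using h(2) by (simp only: nat_pow_mult [OF u] flip: mult_2)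
        also have "\<dots> = \<one>"
          unfolding j using g_power_eq_1_iff [of "j * (q - 1)"] by (simp add: nat_pow_pow)
        finally show ?thesis .
      qed
      ultimately have "u [^] ?h = \<ominus> \<one>"
        using u square_eq_one by blast
      then show ?thesis
        unfolding c using odd_p by (simp add: int_embed_uminus)
    qed
  qed
  then show "[c] \<cdot> \<one> = u [^] ?h" "c ^ p = c"
    by auto
qed

end

lemma sum_const_poly: "(\<Sum>i\<in>S. [:c i:]) = [:\<Sum>i\<in>S. c i:]"
  by (induction S rule: infinite_finite_induct) simp_all

context cyclic_field
begin

abbreviation (input) cubic :: "'a \<Rightarrow> 'a" where
  "cubic x \<equiv> x [^] (3::nat) \<oplus> \<one> \<otimes> x \<oplus> \<zero>"

abbreviation (input) excess :: "'a \<Rightarrow> int" where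
  "excess x \<equiv> int (card {y \<in> carrier F. y [^] (2::nat) = cubic x}) - 1"

lemma card_points_eq: "int (card (weierstrass_points F \<one> \<zero>)) = 1 + int q + (\<Sum>x\<in>carrier F. excess x)"
proof -
  let ?S = "SIGMA x:carrier F. {y \<in> carrier F. y [^] (2::nat) = cubic x}"
  have fin: "finite ?S"
    using finite_F by (intro finite_SigmaI) auto
  have "weierstrass_points F \<one> \<zero> = insert Infinity (case_prod Affine ` ?S)"
    unfolding weierstrass_points_def by auto
  moreover have "Infinity \<notin> case_prod Affine ` ?S"
    by auto
  moreover have "inj_on (case_prod Affine) ?S"
    by (auto simp: inj_on_def)
  ultimately have "card (weierstrass_points F \<one> \<zero>) = Suc (card ?S)"
    using fin by (simp add: card_image)
  also have "card ?S = (\<Sum>x\<in>carrier F. card {y \<in> carrier F. y [^] (2::nat) = cubic x})"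
    using finite_F by (intro card_SigmaI) auto
  finally show ?thesis
    by (simp add: sum_subtractf card_F)
qed

lemma excess_zero: "excess \<zero> = 0"
proof -
  have "{y \<in> carrier F. y [^] (2::nat) = cubic \<zero>} = {\<zero>}"
    by (auto simp: numeral_2_eq_2 numeral_3_eq_3 integral_iff)
  then show ?thesis
    by simp
qed

lemma sum_excess_eq: "(\<Sum>x\<in>carrier F. excess x) = (\<Sum>j<q-1. excess (g [^] j))"
proof -
  have "(\<Sum>x\<in>carrier F. excess x) = excess \<zero> + (\<Sum>x\<in>carrier F - {\<zero>}. excess x)"
    using finite_F by (intro sum.remove) auto
  also have "(\<Sum>x\<in>carrier F - {\<zero>}. excess x) = (\<Sum>j<q-1. excess (g [^] j))"
    unfolding nonzero_eq_powers by (simp only: sum.reindex [OF inj_powers] o_def)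
  finally show ?thesis
    by (simp only: excess_zero add_0_left)
qed

text \<open>
  For \<open>x = g ^ j\<close> the quadratic character of \<open>x\<^sup>3 + x\<close> is the power with exponent \<open>n\<close> of
  \<open>teich ^ (3 j) + teich ^ j\<close>. After expanding this by the binomial theorem, the sum over \<open>j\<close> selects
  the exponents \<open>n + 2 i\<close> that are divisible by \<open>q - 1\<close>.
\<close>

lemma card_points_cong_sum_choose:
  defines "n \<equiv> p * ((q - 1) div 2)"
  shows "[int (card (weierstrass_points F \<one> \<zero>)) =
    1 + int q + int (q - 1) * int (\<Sum>i\<in>{i. i \<le> n \<and> q - 1 dvd n + 2 * i}. n choose i)] (mod (int p)\<^sup>2)"
proof -
  obtain f where f: "lead_coeff f = 1" "degree f > 0"
    and lift: "\<And>P Q. ev P = ev Q \<Longrightarrow> poly_cong ((int p)\<^sup>2) f (P ^ p) (Q ^ p)"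
    by (rule exists_modulus) blast
  note f_lift = f lift
  let ?pc = "poly_cong ((int p)\<^sup>2) f" and ?h = "(q - 1) div 2"
  have ev_teich: "ev (teich ^ i) = g [^] i" for i
    by (rule ev_teich_power [OF f_lift])
  let ?D = "\<lambda>i. if q - 1 dvd n + 2 * i then [:int (q - 1):] else 0"
  have excess: "?pc [:excess (g [^] j):] (\<Sum>i\<le>n. of_nat (n choose i) * teich ^ (j * (n + 2 * i)))" for j
  proof -
    let ?P = "teich ^ (3 * j) + teich ^ j"
    have "ev ?P = cubic (g [^] j)"
      by (simp add: eval_poly_add ev_teich nat_pow_pow mult.commute)
    then have "ev (?P ^ ?h) = ev [:excess (g [^] j):]"
      using card_square_roots(1) [of "cubic (g [^] j)"] by (simp add: eval_poly_power eval_poly_const)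
    then have "?pc ((?P ^ ?h) ^ p) ([:excess (g [^] j):] ^ p)"
      by (rule lift)
    moreover have "[:excess (g [^] j):] ^ p = [:excess (g [^] j):]"
      using card_square_roots(2) [of "cubic (g [^] j)"] by (simp add: poly_const_pow)
    moreover have "(?P ^ ?h) ^ p = ?P ^ n"
      unfolding n_def by (metis mult.commute power_mult)
    moreover have "?P ^ n = (\<Sum>i\<le>n. of_nat (n choose i) * teich ^ (j * (n + 2 * i)))"
      unfolding binomial_ring
    proof (intro sum.cong refl)
      fix i assume "i \<in> {..n}"
      then have "3 * j * i + j * (n - i) = j * (n + 2 * i)"
        by (auto simp: algebra_simps dest!: le_Suc_ex)
      then show "of_nat (n choose i) * (teich ^ (3 * j)) ^ i * (teich ^ j) ^ (n - i) =
          of_nat (n choose i) * teich ^ (j * (n + 2 * i))"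
        by (simp only: mult.assoc flip: power_mult power_add)
    qed
    ultimately show ?thesis
      by (simp add: poly_cong_sym)
  qed
  have "?pc (\<Sum>j<q-1. [:excess (g [^] j):]) (\<Sum>j<q-1. \<Sum>i\<le>n. of_nat (n choose i) * teich ^ (j * (n + 2 * i)))"
    by (intro poly_cong_sum excess)
  also have "(\<Sum>j<q-1. \<Sum>i\<le>n. of_nat (n choose i) * teich ^ (j * (n + 2 * i))) =
      (\<Sum>i\<le>n. of_nat (n choose i) * (\<Sum>j<q-1. teich ^ (j * (n + 2 * i))))"
    by (subst sum.swap) (simp only: sum_distrib_left)
  also have "?pc \<dots> (\<Sum>i\<le>n. of_nat (n choose i) * ?D i)"
    by (intro poly_cong_sum poly_cong_mult_left sum_teich_powers [OF f_lift])
  also have "(\<Sum>i\<le>n. of_nat (n choose i) * ?D i) = (\<Sum>i\<in>{i. i \<le> n \<and> q - 1 dvd n + 2 * i}. of_nat (n choose i) * [:int (q - 1):])"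
    by (rule sum.mono_neutral_cong_right) auto
  also have "\<dots> = [:int (q - 1) * int (\<Sum>i\<in>{i. i \<le> n \<and> q - 1 dvd n + 2 * i}. n choose i):]"
    unfolding sum_distrib_right [symmetric] of_nat_sum [symmetric] of_nat_poly by (simp add: mult.commute sum_const_poly)
  finally have "?pc (\<Sum>j<q-1. [:excess (g [^] j):]) [:int (q - 1) * int (\<Sum>i\<in>{i. i \<le> n \<and> q - 1 dvd n + 2 * i}. n choose i):]" .
  moreover have "(\<Sum>j<q-1. [:excess (g [^] j):]) = [:\<Sum>j<q-1. excess (g [^] j):]"
    by (rule sum_const_poly)
  ultimately have "?pc [:(\<Sum>j<q-1. excess (g [^] j)) - int (q - 1) * int (\<Sum>i\<in>{i. i \<le> n \<and> q - 1 dvd n + 2 * i}. n choose i):] 0"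
    unfolding poly_cong_def by simp
  then have "(int p)\<^sup>2 dvd (\<Sum>j<q-1. excess (g [^] j)) - int (q - 1) * int (\<Sum>i\<in>{i. i \<le> n \<and> q - 1 dvd n + 2 * i}. n choose i)"
    by (rule poly_cong_const_imp_dvd [OF f])
  then show ?thesis
    unfolding card_points_eq sum_excess_eq by (simp add: cong_iff_dvd_diff algebra_simps)
qed

end

lemma (in cring) int_embed_power: "[(a ^ n :: int)] \<cdot> \<one> = ([a] \<cdot> \<one>) [^] n"
  by (induction n) (simp_all add: int_embed_mult m_comm)

lemma (in field) prime_eq_zero_if_card_prime_power:
  assumes "card (carrier R) = p ^ n" "p > 0"
  shows "[int p] \<cdot> \<one> = \<zero>"
proof -
  have "[int (p ^ n)] \<cdot> \<one> = \<zero>"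
    using add.pow_order_eq_1 [of \<one>] assms by (simp add: Coset.order_def add_pow_int_ge nat_power_eq)
  then have "([int p] \<cdot> \<one>) [^] n = \<zero>"
    using int_embed_power [of "int p" n] by simp
  moreover have "x [^] (n::nat) \<noteq> \<zero>" if "x \<in> carrier R" "x \<noteq> \<zero>" for x n
    using that by (induction n) (simp_all add: integral_iff)
  ultimately show ?thesis
    using int_embed_closed by blast
qed

lemma (in field) exists_generator:
  assumes "card (carrier R) = q" "q > 1"
  obtains g where "g \<in> carrier R" "g \<noteq> \<zero>" "\<And>n::nat. g [^] n = \<one> \<longleftrightarrow> q - 1 dvd n"
    "carrier R - {\<zero>} = (\<lambda>j::nat. g [^] j) ` {..<q-1}" "inj_on (\<lambda>j::nat. g [^] j) {..<q-1}"
proof -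
  have fin: "finite (carrier R)"
    using assms card.infinite by fastforce
  interpret G: group "mult_of R"
    rewrites "([^]\<^bsub>mult_of R\<^esub>) = (([^]) :: _ \<Rightarrow> nat \<Rightarrow> _)" and "\<one>\<^bsub>mult_of R\<^esub> = \<one>"
    by (rule field_mult_group) (simp_all add: mult_of_simps)
  have finM: "finite (carrier (mult_of R))"
    using fin by simp
  obtain g where g: "g \<in> carrier (mult_of R)" "carrier (mult_of R) = {g [^] i | i::nat. i \<in> UNIV}"
    using finite_field_mult_group_has_gen [OF fin] by blast
  have "G.ord g \<ge> 1"
    using G.ord_ge_1 [OF finM g(1)] .
  then have set: "{0..G.ord g - 1} = {..<G.ord g}"
    by auto
  have elems: "carrier (mult_of R) = (\<lambda>j::nat. g [^] j) ` {..<G.ord g}"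
    using G.ord_elems [OF finM g(1)] g(2) unfolding set by auto
  have inj: "inj_on (\<lambda>j::nat. g [^] j) {..<G.ord g}"
    using G.ord_inj [OF g(1)] unfolding set .
  have "G.ord g = card (carrier (mult_of R))"
    unfolding elems by (simp add: card_image [OF inj])
  also have "\<dots> = q - 1"
    using assms fin by simp
  finally have ord: "G.ord g = q - 1" .
  show ?thesis
    by (rule that [of g]) (use g(1) elems inj G.pow_eq_id [OF g(1)] in \<open>simp_all add: ord\<close>)
qed

text \<open>
  This identifies the selected exponents, for \<open>q - 1 = 4 K\<close> and \<open>n = 2 p K\<close>: divisibility of
  \<open>2 (p K + i)\<close> by \<open>4 K\<close> means that \<open>i\<close> is a multiple of \<open>K\<close> of the same parity as \<open>p\<close>.
\<close>

lemma multiples_of_odd_quarters: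
  fixes p :: nat
  assumes "K > 0" "odd p"
  shows "{i. i \<le> 2 * p * K \<and> 4 * K dvd 2 * p * K + 2 * i} = (\<lambda>u. (2 * u + 1) * K) ` {..<p}"
proof (intro equalityI subsetI)
  fix i assume "i \<in> {i. i \<le> 2 * p * K \<and> 4 * K dvd 2 * p * K + 2 * i}"
  then have i: "i \<le> 2 * p * K" "2 * (2 * K) dvd 2 * (p * K + i)"
    by (simp_all add: algebra_simps)
  from i(2) have "2 * K dvd p * K + i"
    unfolding nat_mult_dvd_cancel_disj by simp
  then obtain e where e: "p * K + i = 2 * K * e"
    by blast
  obtain h where h: "p = 2 * h + 1"
    using assms(2) oddE by blast
  have e2: "i + (2 * h + 1) * K = 2 * e * K"
    using e h by (simp add: algebra_simps)
  have "e \<ge> Suc h"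
  proof (rule ccontr)
    assume "\<not> e \<ge> Suc h"
    then have "2 * e * K \<le> 2 * h * K"
      by (intro mult_right_mono) auto
    moreover have "(2 * h + 1) * K = 2 * h * K + K"
      by (simp add: algebra_simps)
    ultimately show False
      using e2 assms(1) by linarith
  qed
  then obtain u where u: "e = Suc h + u"
    using le_Suc_ex by blast
  have iu: "i = (2 * u + 1) * K"
    using e2 unfolding u by (simp add: algebra_simps)
  have "(2 * u + 1) * K \<le> (2 * p) * K"
    using i(1) unfolding iu .
  then have "2 * u + 1 \<le> 2 * p"
    using assms by (simp only: mult_le_cancel2)
  then show "i \<in> (\<lambda>u. (2 * u + 1) * K) ` {..<p}"
    using iu by auto
next
  fix i assume "i \<in> (\<lambda>u. (2 * u + 1) * K) ` {..<p}"
  then obtain u where u: "u < p" "i = (2 * u + 1) * K"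
    by blast
  obtain h where h: "p = 2 * h + 1"
    using assms(2) oddE by blast
  have "(2 * u + 1) * K \<le> (2 * p) * K"
    using u(1) by (intro mult_right_mono) auto
  moreover have "2 * p * K + 2 * i = 4 * K * (h + u + 1)"
    unfolding u(2) h by (simp add: algebra_simps)
  then have "4 * K dvd 2 * p * K + 2 * i"
    by (metis dvd_triv_left)
  ultimately show "i \<in> {i. i \<le> 2 * p * K \<and> 4 * K dvd 2 * p * K + 2 * i}"
    using u(2) by (simp only: mem_Collect_eq)
qed

text \<open>
  Since \<open>q \<equiv> 0\<close> modulo \<open>p\<^sup>2\<close>, the number of points is \<open>1\<close> minus the sum of binomial coefficients.
\<close>

lemma card_points_cong_gauss_fact:
  fixes F :: "('a, 'r) ring_scheme"
  assumes "field F" "prime p" "p = 4 * k + 1" "card (carrier F) = p ^ (p - 1)"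
  shows "[int (card (weierstrass_points F \<one>\<^bsub>F\<^esub> \<zero>\<^bsub>F\<^esub>)) = 2 * int (gauss_fact p (p * k + k)) ^ (p - 1) - 2] (mod (int p)\<^sup>2)"
proof -
  interpret field F by fact
  let ?q = "p ^ (p - 1)" and ?K = "quarter p (p - 1)"
  have p4: "p > 4"
    using assms prime_1_mod_4_index_pos [OF assms(2,3)] by simp
  then have q1: "?q > 1"
    by (intro one_less_power) auto
  obtain g where g: "g \<in> carrier F" "g \<noteq> \<zero>\<^bsub>F\<^esub>" "\<And>n::nat. g [^]\<^bsub>F\<^esub> n = \<one>\<^bsub>F\<^esub> \<longleftrightarrow> ?q - 1 dvd n"
    "carrier F - {\<zero>\<^bsub>F\<^esub>} = (\<lambda>j::nat. g [^]\<^bsub>F\<^esub> j) ` {..<?q-1}" "inj_on (\<lambda>j::nat. g [^]\<^bsub>F\<^esub> j) {..<?q-1}"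
    using exists_generator [OF assms(4) q1] by blast
  interpret cyclic_field F p ?q g
  proof
    show "odd p" "odd ?q" "p dvd ?q"
      using assms(3) p4 by (simp_all add: dvd_power)
    show "[int p] \<cdot>\<^bsub>F\<^esub> \<one>\<^bsub>F\<^esub> = \<zero>\<^bsub>F\<^esub>"
      using prime_eq_zero_if_card_prime_power [OF assms(4)] p4 by simp
  qed (use assms g q1 in auto)
  have qK: "?q - 1 = 4 * ?K"
    using quarter_eq [OF assms(2,3), of "p - 1"] by simp
  have "Suc (p - 2) = p - 1"
    using p4 by simp
  then have K: "?K > 0"
    using quarter_pos [OF assms(2,3), of "p - 2"] by simp
  have n: "p * ((?q - 1) div 2) = 2 * p * ?K"
    unfolding qK by simp
  let ?S = "\<Sum>u<p. (2 * p * ?K) choose ((2 * u + 1) * ?K)"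
  have S: "(\<Sum>i\<in>{i. i \<le> 2 * p * ?K \<and> 4 * ?K dvd 2 * p * ?K + 2 * i}. (2 * p * ?K) choose i) = ?S"
    unfolding multiples_of_odd_quarters [OF K odd_p]
    using K by (subst sum.reindex) (auto simp: inj_on_def)
  have 1: "[int (card (weierstrass_points F \<one>\<^bsub>F\<^esub> \<zero>\<^bsub>F\<^esub>)) = 1 + int ?q + int (?q - 1) * int ?S] (mod (int p)\<^sup>2)"
    using card_points_cong_sum_choose [unfolded n] unfolding qK S .
  have q0: "[int ?q = 0] (mod (int p)\<^sup>2)"
    unfolding cong_0_iff of_nat_power using p4 by (intro le_imp_power_dvd) simp
  have "[int ?q - 1 = 0 - 1] (mod (int p)\<^sup>2)"
    by (intro cong_diff q0 cong_refl)
  moreover have "int (?q - 1) = int ?q - 1"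
    using q1 by (simp only: of_nat_diff)
  ultimately have "[int (?q - 1) = - 1] (mod (int p)\<^sup>2)"
    by (simp only: diff_0)
  then have "[1 + int ?q + int (?q - 1) * int ?S = 1 + 0 + (- 1) * (3 - 2 * int (gauss_fact p (p * k + k)) ^ (p - 1))] (mod (int p)\<^sup>2)"
    by (intro cong_add cong_mult q0 cong_refl sum_choose_odd_quarters_cong [OF assms(2,3)])
  from cong_trans [OF 1 this] show ?thesis
    by simp
qed

section \<open>The three conditions\<close>

text \<open>
  Put \<open>x = G ^ (p - 1) - 1\<close>. The two power sums are \<open>x + p k\<close> and \<open>2 p k\<close>. The terms with \<open>p k\<close>
  cancel because \<open>2 ^ (p - 1)\<close> is \<open>1\<close> modulo \<open>p\<close>, and that power can be dropped in front of \<open>x\<close>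
  because \<open>p\<close> divides \<open>x\<close>.
\<close>

lemma euler_number_cong_gauss_fact:
  assumes "prime p" "p = 4 * k + 1"
  shows "[euler_number (p - 1) = 4 * (int (gauss_fact p (p * k + k)) ^ (p - 1) - 1)] (mod (int p)\<^sup>2)"
proof -
  let ?m = "p * k + k" and ?M = "(int p)\<^sup>2"
  have p4: "p > 4" and k: "k > 0" and odd: "odd p"
    using assms prime_1_mod_4_index_pos [OF assms] by simp_all
  have M: "?M = int (4 * ?m + 1)" "p\<^sup>2 = 2 * (2 * ?m) + 1"
    using assms(2) by (simp_all add: power2_eq_square algebra_simps)
  define x where "x = int (gauss_fact p ?m) ^ (p - 1) - 1"
  define y where "y = (2 :: int) ^ (p - 1) - 1"
  have p2: "p > 2"
    using p4 by simp
  have n1: "int (?m - ?m div p) = int p * int k" "int (2 * ?m - 2 * ?m div p) = 2 * int p * int k"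
  proof -
    have p0: "p \<noteq> 0"
      using p4 by simp
    have "?m = k + p * k" "2 * ?m = 2 * k + p * (2 * k)" "k div p = 0" "2 * k div p = 0"
      using assms(2) by (simp_all add: algebra_simps)
    then have "?m div p = k" "2 * ?m div p = 2 * k"
      using div_mult_self2 [OF p0, of k k] div_mult_self2 [OF p0, of "2 * k" "2 * k"] by (simp_all only: add_0_right)
    then show "int (?m - ?m div p) = int p * int k" "int (2 * ?m - 2 * ?m div p) = 2 * int p * int k"
      by (simp_all add: algebra_simps)
  qed
  have s1: "[(\<Sum>i=1..?m. int i ^ (p - 1)) = x + int p * int k] (mod ?M)"
    using power_sum_cong_gauss_fact [OF assms(1) p2, of ?m] unfolding n1 x_def .
  have "[int (gauss_fact p (2 * ?m)) ^ (p - 1) = 1] (mod ?M)"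
    by (rule gauss_fact_half_power_cong [OF assms(1) odd M(2)])
  then have "[int (gauss_fact p (2 * ?m)) ^ (p - 1) - 1 + 2 * int p * int k = 1 - 1 + 2 * int p * int k] (mod ?M)"
    by (intro cong_add cong_diff cong_refl)
  from cong_trans [OF power_sum_cong_gauss_fact [OF assms(1) p2, of "2 * ?m", unfolded n1] this]
  have s2: "[(\<Sum>i=1..2*?m. int i ^ (p - 1)) = 2 * int p * int k] (mod ?M)"
    by simp
  have "[euler_number (p - 1) = 2 * 2 ^ (p - 1) * (2 * 2 ^ (p - 1) * (\<Sum>i=1..?m. int i ^ (p - 1)) - (\<Sum>i=1..2*?m. int i ^ (p - 1)))] (mod ?M)"
    unfolding M(1) using odd p4 by (intro euler_number_cong_power_sums) auto
  moreover have "[2 * 2 ^ (p - 1) * (2 * 2 ^ (p - 1) * (\<Sum>i=1..?m. int i ^ (p - 1)) - (\<Sum>i=1..2*?m. int i ^ (p - 1))) =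
      2 * 2 ^ (p - 1) * (2 * 2 ^ (p - 1) * (x + int p * int k) - 2 * int p * int k)] (mod ?M)"
    by (intro cong_scalar_left cong_diff s1 s2)
  moreover have "[2 * 2 ^ (p - 1) * (2 * 2 ^ (p - 1) * (x + int p * int k) - 2 * int p * int k) = 4 * x] (mod ?M)"
  proof -
    have "\<not> p dvd gauss_fact p ?m" "\<not> p dvd 2"
      using coprime_gauss_fact [OF assms(1), of ?m] assms(1) coprime_absorb_right not_prime_unit p4
      by (blast, auto dest: dvd_imp_le)
    then have "int p dvd x" "int p dvd y"
      using fermat_power [OF assms(1)] unfolding x_def y_def
      by (simp_all add: cong_iff_dvd_diff) (metis of_nat_numeral)
    then obtain a b where ab: "x = int p * a" "y = int p * b"
      by blast
    have "(2 :: int) ^ (p - 1) = 1 + int p * b"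
      using ab(2) unfolding y_def by simp
    then have "2 * 2 ^ (p - 1) * (2 * 2 ^ (p - 1) * (x + int p * int k) - 2 * int p * int k) - 4 * x =
        ?M * (8 * b * a + 4 * int p * b * b * a + 4 * b * int k + 4 * int p * b * b * int k)"
      unfolding ab(1) by (simp add: algebra_simps power2_eq_square)
    then show ?thesis
      by (simp add: cong_iff_dvd_diff)
  qed
  ultimately show ?thesis
    unfolding x_def using cong_trans by blast
qed

lemma one_exceptional_iff_gauss_fact:
  assumes "prime p" "p = 4 * k + 1"
  shows "one_exceptional p 4 \<longleftrightarrow> [int (gauss_fact p (p * k + k)) ^ (p - 1) = 1] (mod (int p)\<^sup>2)"
proof -
  let ?m = "p * k + k"
  have m: "(p\<^sup>2 - 1) div 4 = ?m"
    using assms(2) by (simp add: power2_eq_square algebra_simps)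
  have "(\<Prod>a\<in>{a. 1 \<le> a \<and> a \<le> ?m \<and> coprime a p}. a ^ (p - 1)) = (\<Prod>a=1..?m. (if p dvd a then 1 else a) ^ (p - 1))"
  proof (rule prod.mono_neutral_cong_left)
    have "coprime a p \<longleftrightarrow> \<not> p dvd a" for a
      using assms(1) by (metis coprime_absorb_right coprime_commute not_prime_unit prime_imp_coprime)
    then show "\<forall>a\<in>{1..?m} - {a. 1 \<le> a \<and> a \<le> ?m \<and> coprime a p}. (if p dvd a then 1 else a) ^ (p - 1) = 1"
      "\<And>a. a \<in> {a. 1 \<le> a \<and> a \<le> ?m \<and> coprime a p} \<Longrightarrow> a ^ (p - 1) = (if p dvd a then 1 else a) ^ (p - 1)"
      by auto
  qed auto
  also have "\<dots> = gauss_fact p ?m ^ (p - 1)"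
    unfolding gauss_fact_def by (rule prod_power_distrib [symmetric])
  finally have "one_exceptional p 4 \<longleftrightarrow> [gauss_fact p ?m ^ (p - 1) = 1] (mod p\<^sup>2)"
    unfolding one_exceptional_def m using assms by (simp add: cong_def)
  also have "\<dots> \<longleftrightarrow> [int (gauss_fact p ?m) ^ (p - 1) = 1] (mod (int p)\<^sup>2)"
    by (simp flip: cong_int_iff)
  finally show ?thesis .
qed

theorem proposition5p3:
  fixes p q :: nat
    and F :: "('a, 'r) ring_scheme"
  assumes "Factorial_Ring.prime p"
    and "[p = 1] (mod 4)"
    and "q = p ^ (p - 1)"
    and "field F"
    and "card (carrier F) = q"
  shows "(one_exceptional p 4 \<longleftrightarrow> [euler_number (p - 1) = 0] (mod (int p)\<^sup>2)) \<and>
    ([euler_number (p - 1) = 0] (mod (int p)\<^sup>2) \<longleftrightarrow>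
       [card (weierstrass_points F \<one>\<^bsub>F\<^esub> \<zero>\<^bsub>F\<^esub>) = 0] (mod p\<^sup>2))"
proof -
  obtain k where pk: "p = 4 * k + 1"
  proof -
    have "p mod 4 = 1"
      using assms(2) by (simp add: cong_def)
    then have "p = 4 * (p div 4) + 1"
      by presburger
    then show ?thesis
      using that by blast
  qed
  define x where "x = int (gauss_fact p (p * k + k)) ^ (p - 1) - 1"
  have odd: "odd p"
    using pk by simp
  have c: "coprime 4 ((int p)\<^sup>2)" "coprime 2 ((int p)\<^sup>2)"
  proof -
    have "coprime 2 (int p)"
      using odd by simp
    then show "coprime 2 ((int p)\<^sup>2)"
      by simp
    from coprime_power_left_iff [of 2 2 "(int p)\<^sup>2"] this show "coprime 4 ((int p)\<^sup>2)"
      by simp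
  qed
  have "one_exceptional p 4 \<longleftrightarrow> [x = 0] (mod (int p)\<^sup>2)"
    unfolding one_exceptional_iff_gauss_fact [OF assms(1) pk] x_def by (simp add: cong_iff_dvd_diff)
  moreover have "[euler_number (p - 1) = 0] (mod (int p)\<^sup>2) \<longleftrightarrow> [4 * x = 4 * 0] (mod (int p)\<^sup>2)"
    using euler_number_cong_gauss_fact [OF assms(1) pk] unfolding x_def [symmetric] by (simp add: cong_def)
  moreover have "[card (weierstrass_points F \<one>\<^bsub>F\<^esub> \<zero>\<^bsub>F\<^esub>) = 0] (mod p\<^sup>2) \<longleftrightarrow> [2 * x = 2 * 0] (mod (int p)\<^sup>2)"
  proof -
    have "card (carrier F) = p ^ (p - 1)"
      using assms by simp
    from card_points_cong_gauss_fact [OF assms(4,1) pk this]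
    have "[int (card (weierstrass_points F \<one>\<^bsub>F\<^esub> \<zero>\<^bsub>F\<^esub>)) = 2 * x] (mod (int p)\<^sup>2)"
      unfolding x_def by simp
    then have "[int (card (weierstrass_points F \<one>\<^bsub>F\<^esub> \<zero>\<^bsub>F\<^esub>)) = int 0] (mod int (p\<^sup>2)) \<longleftrightarrow> [2 * x = 2 * 0] (mod (int p)\<^sup>2)"
      by (simp add: cong_def)
    then show ?thesis
      by (simp only: cong_int_iff)
  qed
  ultimately show ?thesis
    by (simp only: cong_mult_lcancel [OF c(1)] cong_mult_lcancel [OF c(2)])
qed

end
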